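(* Let $m\ge0$ and $\ell\ge0$ be fixed integers. For any fixed integer $i\ge1$ and any $\varepsilon>0$ there exist strictly positive constants $C_1,C_2,C_3,c_1,c_2$ (that may depend on $i$ and $\varepsilon$, as well as on $m,\ell$) such that for all $n\ge i$ (with $n>\ell$ and $n\ge2$) and all integers $k\ge0$, $$\mathbb P[M_{n,i}(\tau_n)-b_n>k]\le C_1e^{-(1-\varepsilon)k/e},$$ $$\mathbb P[M_{n,i}(\tau_n)-b_n\le-k]\le C_2e^{-c_1e^{c_2k}}\le C_3e^{-k}.$$
   Context: Let $(\Pi_i(t),t\ge 0)$, $i=1,2,\dots$, be i.i.d. unit-rate Poisson counting processes. For $n>\ell$ let $\tau_n:=\min\{t\ge 0:\Pi_i(t)>m\text{ for all but }\ell\text{ indices }i\in\{1,\dots,n\}\}$. Let $M_{n,1}(t)\ge\cdots\ge M_{n,n}(t)$ be the nonincreasing order statistics of $\Pi_1(t),\dots,\Pi_n(t)$. With $L:=\log n$, put $$a_n:=eL+\Big((e-1)m-\tfrac12\Big)\log L-\log\Big((e-1)(m!)^{e-1}\sqrt{2\pi e}\Big),\quad b_n:=\lfloor a_n\rfloor .$$ *)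

theory Defs
  imports "HOL-Probability.Probability"
begin

text \<open>
  Time is the type of reals; only times \<open>t \<ge> 0\<close> are constrained, and values of
  \<open>N t\<close> at negative \<open>t\<close> are irrelevant.  Natural subtraction does not truncate in
  the increments because paths are nondecreasing.  The two increment axioms and
  \<open>N 0 = 0\<close> determine the law of the process (in particular \<open>N t\<close> is Poisson with mean
  \<open>t\<close> and jumps are almost surely of size one).
\<close>

locale unit_poisson_process = prob_space M
  for M :: "'a measure" +
  fixes N :: "real \<Rightarrow> 'a \<Rightarrow> nat"
  assumes measurable_process: "0 \<le> t \<Longrightarrow> random_variable (count_space UNIV) (N t)"
    and start_zero: "\<omega> \<in> space M \<Longrightarrow> N 0 \<omega> = 0"
    and mono_paths: "\<omega> \<in> space M \<Longrightarrow> mono_on {0..} (\<lambda>t. N t \<omega>)"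
    and right_continuous_paths:
      "\<omega> \<in> space M \<Longrightarrow> 0 \<le> t \<Longrightarrow> continuous (at_right t) (\<lambda>s. N s \<omega>)"
    and poisson_increments:
      "0 \<le> s \<Longrightarrow> s < t \<Longrightarrow>
        distr M (count_space UNIV) (\<lambda>\<omega>. N t \<omega> - N s \<omega>) = measure_pmf (poisson_pmf (t - s))"
    and independent_increments:
      "0 \<le> T 0 \<Longrightarrow> (\<And>j. j < r \<Longrightarrow> T j \<le> T (Suc j)) \<Longrightarrow>
        indep_vars (\<lambda>_. count_space UNIV) (\<lambda>j \<omega>. N (T (Suc j)) \<omega> - N (T j) \<omega>) {..<r}"

text \<open>
  Independence is that of the processes as random elements of the path space
  \<open>\<nat>\<^bsup>[0,\<infinity>)\<^esup>\<close> with its product sigma-algebra.  They are identically distributed because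
  every \<open>P i\<close> has the law of the unit-rate Poisson process.  Indices start at 1.
\<close>

locale iid_unit_poisson_processes = prob_space M
  for M :: "'a measure" +
  fixes P :: "nat \<Rightarrow> real \<Rightarrow> 'a \<Rightarrow> nat"
  assumes unit_poisson: "1 \<le> i \<Longrightarrow> unit_poisson_process M (P i)"
    and independent_processes:
      "indep_vars (\<lambda>_. PiM {0..} (\<lambda>_. count_space UNIV)) (\<lambda>i \<omega>. \<lambda>t\<in>{0..}. P i t \<omega>) {1..}"

text \<open>
  \<open>all_but P m l n \<omega> t\<close>: at time \<open>t\<close> at most \<open>l\<close> of the counts with index in \<open>{1..n}\<close> are
  still \<open>\<le> m\<close>, i.e. the others all exceed \<open>m\<close>.  For \<open>l < n\<close> the first time at which this
  holds is almost surely also the first time at which exactly \<open>l\<close> are, since almost surely no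
  two independent processes jump simultaneously.
\<close>

definition all_but :: "(nat \<Rightarrow> real \<Rightarrow> 'a \<Rightarrow> nat) \<Rightarrow> nat \<Rightarrow> nat \<Rightarrow> nat \<Rightarrow> 'a \<Rightarrow> real \<Rightarrow> bool" where
  "all_but P m l n \<omega> t \<longleftrightarrow> card {i \<in> {1..n}. \<not> P i t \<omega> > m} \<le> l"

text \<open>
  The minimum exists whenever the set of admissible times is nonempty, by right-continuity and
  monotonicity of the paths (see below).  The value 0 on the null event where that set is empty
  is a convention, chosen so that \<open>P i (tau P m l n \<omega>) \<omega>\<close> is a random variable.
\<close>

definition tau :: "(nat \<Rightarrow> real \<Rightarrow> 'a \<Rightarrow> nat) \<Rightarrow> nat \<Rightarrow> nat \<Rightarrow> nat \<Rightarrow> 'a \<Rightarrow> real" where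
  "tau P m l n \<omega> =
    (if \<exists>t\<ge>0. all_but P m l n \<omega> t then LEAST t. 0 \<le> t \<and> all_but P m l n \<omega> t else 0)"

text \<open>The \<open>i\<close>-th largest (with multiplicity, \<open>1 \<le> i \<le> n\<close>) of \<open>P 1 t, \<dots>, P n t\<close>.\<close>

definition order_stat :: "(nat \<Rightarrow> real \<Rightarrow> 'a \<Rightarrow> nat) \<Rightarrow> nat \<Rightarrow> nat \<Rightarrow> real \<Rightarrow> 'a \<Rightarrow> nat" where
  "order_stat P n i t \<omega> = rev (sort (map (\<lambda>j. P j t \<omega>) [1..<Suc n])) ! (i - 1)"

definition centering_a :: "nat \<Rightarrow> nat \<Rightarrow> real" where
  "centering_a m n =
    exp 1 * ln (real n) + ((exp 1 - 1) * real m - 1 / 2) * ln (ln (real n))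
      - ln ((exp 1 - 1) * fact m powr (exp 1 - 1) * sqrt (2 * pi * exp 1))"

definition centering_b :: "nat \<Rightarrow> nat \<Rightarrow> int" where
  "centering_b m n = \<lfloor>centering_a m n\<rfloor>"

context iid_unit_poisson_processes
begin

lemma all_but_mono:
  assumes "\<omega> \<in> space M" "0 \<le> s" "s \<le> t" "all_but P m l n \<omega> s"
  shows "all_but P m l n \<omega> t"
proof -
  have "P i s \<omega> \<le> P i t \<omega>" if "i \<in> {1..n}" for i
  proof -
    interpret unit_poisson_process M "P i" using unit_poisson that by simp
    show ?thesis using mono_onD[OF mono_paths[OF assms(1)], of s t] assms by simp
  qed
  then have "{i \<in> {1..n}. \<not> P i t \<omega> > m} \<subseteq> {i \<in> {1..n}. \<not> P i s \<omega> > m}"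
    by fastforce
  then have "card {i \<in> {1..n}. \<not> P i t \<omega> > m} \<le> card {i \<in> {1..n}. \<not> P i s \<omega> > m}"
    by (intro card_mono) auto
  with assms(4) show ?thesis by (simp add: all_but_def)
qed

lemma eventually_right_const:
  assumes "\<omega> \<in> space M" "0 \<le> t" "1 \<le> i"
  shows "eventually (\<lambda>s. P i s \<omega> = P i t \<omega>) (at_right t)"
proof -
  interpret unit_poisson_process M "P i" using unit_poisson assms by simp
  have "((\<lambda>s. P i s \<omega>) \<longlongrightarrow> P i t \<omega>) (at_right t)"
    using right_continuous_paths[OF assms(1,2)] by (simp add: continuous_within)
  then show ?thesis by (simp add: tendsto_discrete)
qed

lemma tau_is_minimum:
  assumes \<omega>: "\<omega> \<in> space M" and ex: "\<exists>t\<ge>0. all_but P m l n \<omega> t"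
  shows "0 \<le> tau P m l n \<omega>" "all_but P m l n \<omega> (tau P m l n \<omega>)"
    and "\<And>s. 0 \<le> s \<Longrightarrow> all_but P m l n \<omega> s \<Longrightarrow> tau P m l n \<omega> \<le> s"
proof -
  define S where "S = {t. 0 \<le> t \<and> all_but P m l n \<omega> t}"
  have S: "S \<noteq> {}" "bdd_below S" using ex by (auto simp: S_def intro!: bdd_belowI[of _ 0])
  define T where "T = Inf S"
  have T0: "0 \<le> T" unfolding T_def by (rule cInf_greatest[OF S(1)]) (simp add: S_def)
  have le: "T \<le> s" if "s \<in> S" for s unfolding T_def by (rule cInf_lower[OF that S(2)])
  have "eventually (\<lambda>s. \<forall>i\<in>{1..n}. P i s \<omega> = P i T \<omega>) (at_right T)"
    using eventually_right_const[OF \<omega> T0] by (simp add: eventually_ball_finite)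
  then obtain d where d: "T < d" "\<And>s. T < s \<Longrightarrow> s < d \<Longrightarrow> \<forall>i\<in>{1..n}. P i s \<omega> = P i T \<omega>"
    by (auto simp: eventually_at_right_field)
  obtain u where u: "u \<in> S" "u < d" using d(1) S cInf_less_iff[OF S] by (auto simp: T_def)
  have "all_but P m l n \<omega> T"
  proof (cases "u = T")
    case False
    then have "\<forall>i\<in>{1..n}. P i u \<omega> = P i T \<omega>" using d(2) u le by force
    then have "{i \<in> {1..n}. \<not> P i u \<omega> > m} = {i \<in> {1..n}. \<not> P i T \<omega> > m}" by auto
    then show ?thesis using u by (simp add: S_def all_but_def)
  qed (use u in \<open>simp add: S_def\<close>)
  moreover have "tau P m l n \<omega> = (LEAST t. 0 \<le> t \<and> all_but P m l n \<omega> t)"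
    using ex by (simp add: tau_def)
  moreover have "\<dots> = T"
    using calculation(1) T0 le by (intro Least_equality) (auto simp: S_def)
  ultimately show "0 \<le> tau P m l n \<omega>" "all_but P m l n \<omega> (tau P m l n \<omega>)"
    "\<And>s. 0 \<le> s \<Longrightarrow> all_but P m l n \<omega> s \<Longrightarrow> tau P m l n \<omega> \<le> s"
    using T0 le by (auto simp: S_def)
qed

lemma measurable_P [measurable]:
  "1 \<le> i \<Longrightarrow> 0 \<le> t \<Longrightarrow> P i t \<in> measurable M (count_space UNIV)"
  using unit_poisson_process.measurable_process[OF unit_poisson] by blast

lemma sets_all_but: "0 \<le> t \<Longrightarrow> {\<omega> \<in> space M. all_but P m l n \<omega> t} \<in> events"
proof -
  assume t: "0 \<le> t"
  have eq: "all_but P m l n \<omega> t \<longleftrightarrow> (\<Sum>i=1..n. if P i t \<omega> > m then 0 else 1::nat) \<le> l" for \<omega>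
    unfolding all_but_def by (simp add: sum.If_cases Int_def conj_commute)
  have [measurable]: "(\<lambda>\<omega>. if P i t \<omega> > m then 0 else 1::nat) \<in> measurable M (count_space UNIV)"
    if "i \<in> {1..n}" for i
    by (rule measurable_compose[OF measurable_P[of i t]]) (use that t in auto)
  show ?thesis unfolding eq by measurable
qed

lemma measurable_tau [measurable]: "tau P m l n \<in> borel_measurable M"
proof (rule borel_measurableI_le)
  fix c :: real
  let ?E = "{\<omega> \<in> space M. \<exists>t\<ge>0. all_but P m l n \<omega> t}"
  have "?E = (\<Union>k::nat. {\<omega> \<in> space M. all_but P m l n \<omega> (real k)})"
  proof (intro equalityI subsetI)
    fix \<omega> assume "\<omega> \<in> ?E"
    then obtain t where t: "\<omega> \<in> space M" "0 \<le> t" "all_but P m l n \<omega> t" by auto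
    then show "\<omega> \<in> (\<Union>k::nat. {\<omega> \<in> space M. all_but P m l n \<omega> (real k)})"
      using all_but_mono[OF t(1,2) _ t(3)] real_arch_simple[of t] by auto
  qed (auto intro: of_nat_0_le_iff)
  then have E: "?E \<in> events" by (auto intro!: sets_all_but)
  show "{\<omega> \<in> space M. tau P m l n \<omega> \<le> c} \<in> events"
  proof (cases "0 \<le> c")
    case True
    have "{\<omega> \<in> space M. tau P m l n \<omega> \<le> c}
      = {\<omega> \<in> space M. all_but P m l n \<omega> c} \<union> (space M - ?E)"
    proof (intro equalityI subsetI)
      fix \<omega> assume "\<omega> \<in> {\<omega> \<in> space M. tau P m l n \<omega> \<le> c}"
      then show "\<omega> \<in> {\<omega> \<in> space M. all_but P m l n \<omega> c} \<union> (space M - ?E)"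
        using tau_is_minimum(1,2)[of \<omega> m l n] all_but_mono[of \<omega> "tau P m l n \<omega>" c m l n] by auto
    next
      fix \<omega> assume "\<omega> \<in> {\<omega> \<in> space M. all_but P m l n \<omega> c} \<union> (space M - ?E)"
      then show "\<omega> \<in> {\<omega> \<in> space M. tau P m l n \<omega> \<le> c}"
      proof
        assume "\<omega> \<in> {\<omega> \<in> space M. all_but P m l n \<omega> c}"
        then show ?thesis using tau_is_minimum(3)[of \<omega> m l n c] True by auto
      qed (use True in \<open>auto simp: tau_def\<close>)
    qed
    then show ?thesis using E sets_all_but[OF True] by auto
  next
    case False
    have "0 \<le> tau P m l n \<omega>" if "\<omega> \<in> space M" for \<omega>
      using tau_is_minimum(1)[OF that, of m l n] by (cases "\<exists>t\<ge>0. all_but P m l n \<omega> t") (auto simp: tau_def)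
    then have "{\<omega> \<in> space M. tau P m l n \<omega> \<le> c} = {}" using False by fastforce
    then show ?thesis by (metis sets.empty_sets)
  qed
qed

lemma tau_nonneg: "\<omega> \<in> space M \<Longrightarrow> 0 \<le> tau P m l n \<omega>"
  using tau_is_minimum(1)[of \<omega> m l n] by (cases "\<exists>t\<ge>0. all_but P m l n \<omega> t") (auto simp: tau_def)

lemma measurable_P_tau:
  assumes i: "1 \<le> i"
  shows "(\<lambda>\<omega>. P i (tau P m l n \<omega>) \<omega>) \<in> measurable M (count_space UNIV)"
proof -
  define D where "D = (\<lambda>r \<omega>. nat (\<lfloor>tau P m l n \<omega> * 2 ^ r\<rfloor> + 1))"
  define X where "X = (\<lambda>(r::nat) \<omega>. real (P i (real (D r \<omega>) / 2 ^ r) \<omega>))"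
  have [measurable]: "D r \<in> measurable M (count_space UNIV)" for r
    unfolding D_def by measurable
  have X: "X r \<in> borel_measurable M" for r
    unfolding X_def
  proof (rule measurable_compose_countable[where g = "D r" and f = "\<lambda>j \<omega>. real (P i (real j / 2 ^ r) \<omega>)"])
    fix j :: nat
    have "P i (real j / 2 ^ r) \<in> measurable M (count_space UNIV)" by (rule measurable_P[OF i]) simp
    then show "(\<lambda>\<omega>. real (P i (real j / 2 ^ r) \<omega>)) \<in> borel_measurable M" by measurable
  qed measurable
  have lim: "(\<lambda>r. X r \<omega>) \<longlonglongrightarrow> real (P i (tau P m l n \<omega>) \<omega>)" if \<omega>: "\<omega> \<in> space M" for \<omega>
  proof -
    let ?t = "tau P m l n \<omega>"
    have t0: "0 \<le> ?t" by (rule tau_nonneg[OF \<omega>])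
    have fl: "real (D r \<omega>) = of_int \<lfloor>?t * 2 ^ r\<rfloor> + 1" for r
      using t0 by (simp add: D_def)
    have lo: "?t < real (D r \<omega>) / 2 ^ r" for r
      unfolding fl by (simp add: field_simps, linarith)
    have hi: "real (D r \<omega>) / 2 ^ r \<le> ?t + (1/2) ^ r" for r
      unfolding fl by (simp add: field_simps power_divide)
    have "(\<lambda>r. ?t + (1/2) ^ r) \<longlonglongrightarrow> ?t + 0" by (intro tendsto_intros) auto
    then have "(\<lambda>r. ?t + (1/2) ^ r) \<longlonglongrightarrow> ?t" by simp
    from tendsto_sandwich[OF always_eventually always_eventually tendsto_const this,
        of "\<lambda>r. real (D r \<omega>) / 2 ^ r"]
    have "(\<lambda>r. real (D r \<omega>) / 2 ^ r) \<longlonglongrightarrow> ?t"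
      using lo hi by (simp add: less_imp_le)
    then have "filterlim (\<lambda>r. real (D r \<omega>) / 2 ^ r) (at_right ?t) sequentially"
      using lo less_imp_neq[OF lo, symmetric] by (simp add: filterlim_at)
    then have "eventually (\<lambda>r. P i (real (D r \<omega>) / 2 ^ r) \<omega> = P i ?t \<omega>) sequentially"
      using eventually_right_const[OF \<omega> t0 i] unfolding filterlim_iff by blast
    then show ?thesis unfolding X_def by (intro tendsto_eventually) (simp add: eventually_mono)
  qed
  have "(\<lambda>\<omega>. real (P i (tau P m l n \<omega>) \<omega>)) \<in> borel_measurable M"
    by (rule borel_measurable_LIMSEQ_real[OF lim X])
  then have "(\<lambda>\<omega>. nat \<lfloor>real (P i (tau P m l n \<omega>) \<omega>)\<rfloor>) \<in> measurable M (count_space UNIV)"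
    by measurable
  then show ?thesis by simp
qed

text \<open>
  \<^term>\<open>measure\<close> is 0 outside the sigma-algebra, so an upper bound on a probability is meaningful
  only for measurable events.
\<close>

lemma measurable_order_stat_tau:
  assumes i: "1 \<le> i" "i \<le> n"
  shows "(\<lambda>\<omega>. order_stat P n i (tau P m l n \<omega>) \<omega>) \<in> measurable M (count_space UNIV)"
proof -
  define F where "F = (\<lambda>\<omega>. map (\<lambda>j. P j (tau P m l n \<omega>) \<omega>) [1..<Suc n])"
  have map: "(\<lambda>\<omega>. map (\<lambda>j. P j (tau P m l n \<omega>) \<omega>) js) \<in> measurable M (count_space UNIV)"
    if "\<forall>j\<in>set js. 1 \<le> j" for js
    using that
  proof (induction js)
    case (Cons j js)
    have [measurable]: "(\<lambda>\<omega>. P j (tau P m l n \<omega>) \<omega>) \<in> measurable M (count_space UNIV)"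
      using Cons.prems by (intro measurable_P_tau) simp
    have [measurable]: "(\<lambda>\<omega>. map (\<lambda>j. P j (tau P m l n \<omega>) \<omega>) js) \<in> measurable M (count_space UNIV)"
      using Cons by simp
    show ?case
      unfolding list.map
      by (rule measurable_compose_countable[where g = "\<lambda>\<omega>. P j (tau P m l n \<omega>) \<omega>"
            and f = "\<lambda>a \<omega>. a # map (\<lambda>j. P j (tau P m l n \<omega>) \<omega>) js"])
        (auto intro: measurable_compose[where N = "count_space UNIV"])
  qed simp
  have "F \<in> measurable M (count_space UNIV)" unfolding F_def by (rule map) auto
  then have "(\<lambda>\<omega>. rev (sort (F \<omega>)) ! (i - 1)) \<in> measurable M (count_space UNIV)"
    by (rule measurable_compose) simp
  then show ?thesis by (simp only: F_def order_stat_def)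
qed

end

end

theory Submission
  imports Defs "HOL-Real_Asymp.Real_Asymp"
begin

text \<open>
  Write \<open>L = ln n\<close>, \<open>a\<close> for the centering sequence and \<open>\<tau>\<close> for the stopping time.  Counts are
  nondecreasing in time, so \<open>\<tau>\<close> can be compared with a deterministic time \<open>t\<close>.  If \<open>\<tau> \<le> t\<close>, the
  order statistics at \<open>\<tau>\<close> are at most those at \<open>t\<close>; if \<open>\<tau> \<ge> t\<close>, they are at least those at \<open>t\<close>.
  Hence each tail is controlled by two events at the time \<open>t\<close>: one about the stragglers (counts
  that are still \<open>\<le> m\<close>), which decide on which side of \<open>t\<close> the time \<open>\<tau>\<close> lies, and one about the
  leaders (counts above the level in question).

  The two expected numbers are explicit.  For fixed \<open>x\<close> and \<open>y\<close> and \<open>t = L + m ln L + x\<close>, the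
  expected number of stragglers is of order \<open>e\<^bsup>-x\<^esup>\<close>, and the expected number of counts that
  exceed \<open>a + y\<close> is of order \<open>e\<^bsup>(e-1)x - y\<^esup>\<close>; the centering \<open>a\<close> is the level for which this order is 1
  at \<open>x = y = 0\<close>.

  For the upper tail, take \<open>y = k\<close> and \<open>x = k/e\<close>.  Since \<open>(e-1)/e - 1 = -1/e\<close>, this choice
  balances the two expected numbers, and the union bounds give \<open>e\<^bsup>-k/e\<^esup>\<close> up to a factor \<open>(1+k)\<^sup>m\<close>
  from the stragglers, which \<open>\<epsilon>\<close> absorbs (\<open>late_time_straggler_bound\<close>,
  \<open>late_time_leader_bound\<close>).  For the lower tail, take \<open>y = -k\<close> and \<open>x = -k/4\<close>.  Now both expected
  numbers are at least a constant times \<open>e\<^bsup>k/4\<^esup>\<close>, while the event requires, up to a null event,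
  at most \<open>l\<close> stragglers or fewer than \<open>i\<close> leaders.  By independence of the processes, a number with mean \<open>\<mu>\<close> is that small
  with probability \<open>O(e\<^bsup>-\<mu>/2\<^esup>)\<close> (\<open>prob_few_at_time_bound\<close>), which is the double exponential.  This
  works for large \<open>n\<close> and \<open>k \<le> L/8\<close>; the event is empty once \<open>k\<close> exceeds \<open>b\<close>, which is \<open>O(L)\<close>, so
  monotonicity in \<open>k\<close> covers the rest with a smaller constant in the inner exponent.

  The Poisson estimates come from a tangent line.  As a function of \<open>j\<close>, Stirling's approximation
  of the logarithm of \<open>e\<^bsup>-t\<^esup> t\<^sup>j / j!\<close> is, apart from the term \<open>- ln j / 2\<close>, concave, and its tangent
  at \<open>j = et\<close> is \<open>(e-1)t - j\<close>.  So \<open>e\<^bsup>(e-1)t - j\<^esup> / \<surd>j\<close> is an upper bound for all \<open>j \<ge> 1\<close> and \<open>t > 0\<close>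
  (\<open>poisson_pmf_le\<close>), and it is attained up to the factor \<open>exp (- (et - j)\<^sup>2 / (et) - 1)\<close>
  (\<open>poisson_pmf_ge\<close>).  The levels near \<open>a\<close> are close to \<open>et\<close>, which is why nothing is lost.
\<close>

section \<open>Stirling's bounds with explicit constants\<close>

lemma ln_one_plus_ge_pade:
  fixes x :: real
  assumes "0 \<le> x"
  shows "2 * x / (2 + x) \<le> ln (1 + x)"
proof -
  have "ln (1 + 0) - 2 * 0 / (2 + 0) \<le> ln (1 + x) - 2 * x / (2 + x)"
  proof (rule DERIV_nonneg_imp_nondecreasing[OF assms])
    fix y :: real
    assume y: "0 \<le> y" "y \<le> x"
    have "((\<lambda>y. ln (1 + y) - 2 * y / (2 + y)) has_real_derivative
        1 / (1 + y) - 4 / (2 + y)\<^sup>2) (at y)"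
      using y by (auto intro!: derivative_eq_intros simp: field_simps power2_eq_square)
    moreover have "1 / (1 + y) - 4 / (2 + y)\<^sup>2 = y\<^sup>2 / ((1 + y) * (2 + y)\<^sup>2)"
      using y by (simp add: divide_simps) (simp add: power2_eq_square algebra_simps)
    moreover have "0 \<le> y\<^sup>2 / ((1 + y) * (2 + y)\<^sup>2)" using y by simp
    ultimately show "\<exists>d. ((\<lambda>y. ln (1 + y) - 2 * y / (2 + y)) has_real_derivative d) (at y) \<and> 0 \<le> d"
      by metis
  qed
  then show ?thesis by simp
qed

lemma ln_one_plus_le_trapezoid:
  fixes x :: real
  assumes "0 \<le> x"
  shows "ln (1 + x) \<le> x * (2 + x) / (2 * (1 + x))"
proof -
  have "0 * (2 + 0) / (2 * (1 + 0)) - ln (1 + 0) \<le> x * (2 + x) / (2 * (1 + x)) - ln (1 + x)"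
  proof (rule DERIV_nonneg_imp_nondecreasing[OF assms])
    fix y :: real
    assume y: "0 \<le> y" "y \<le> x"
    have "((\<lambda>y. y * (2 + y) / (2 * (1 + y)) - ln (1 + y)) has_real_derivative
        (1 + 1 / (1 + y)\<^sup>2) / 2 - 1 / (1 + y)) (at y)"
      using y by (auto intro!: derivative_eq_intros simp: field_simps power2_eq_square)
    moreover have "(1 + 1 / (1 + y)\<^sup>2) / 2 - 1 / (1 + y) = (1 - 1 / (1 + y))\<^sup>2 / 2"
      by (simp add: power2_diff power_one_over algebra_simps add_divide_distrib)
    moreover have "0 \<le> (1 - 1 / (1 + y))\<^sup>2 / 2" by simp
    ultimately show "\<exists>d. ((\<lambda>y. y * (2 + y) / (2 * (1 + y)) - ln (1 + y))
        has_real_derivative d) (at y) \<and> 0 \<le> d"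
      by metis
  qed
  then show ?thesis by simp
qed

text \<open>
  The difference \<open>g\<close> between \<open>ln (j!)\<close> and \<open>(j + 1/2) ln j - j\<close> decreases, because
  \<open>(j + 1/2) ln (1 + 1/j) \<ge> 1\<close>, and \<open>g j - 1/(4j)\<close> increases, because the trapezoid rule for the
  integral of \<open>1/x\<close> overestimates by a telescoping amount.  Both start from \<open>g 1 = 1\<close>.
\<close>

lemma ln_fact_bounds:
  fixes j :: nat
  assumes "1 \<le> j"
  shows "(real j + 1 / 2) * ln j - j + 3 / 4 \<le> ln (fact j)"
    and "ln (fact j) \<le> (real j + 1 / 2) * ln j - j + 1"
proof -
  define g where "g = (\<lambda>j::nat. ln (fact j) - ((real j + 1 / 2) * ln j - j))"
  have monotone: "g (Suc j) \<le> g j \<and> g j - 1 / (4 * j) \<le> g (Suc j) - 1 / (4 * Suc j)"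
    if j: "1 \<le> j" for j :: nat
  proof -
    let ?x = "1 / real j"
    have pos: "real j > 0" using j by simp
    have "ln (real (Suc j)) = ln (real j * (1 + ?x))"
      using pos by (simp add: distrib_left)
    also have "\<dots> = ln (real j) + ln (1 + ?x)"
      using pos by (intro ln_mult_pos) (auto intro: add_pos_pos)
    finally have ln_Suc: "ln (real (Suc j)) = ln (real j) + ln (1 + ?x)" .
    have "ln (fact (Suc j) :: real) = ln (real (Suc j)) + ln (fact j)"
      unfolding fact_Suc by (subst ln_mult) auto
    then have diff: "g j - g (Suc j) = (real j + 1 / 2) * ln (1 + ?x) - 1"
      unfolding g_def ln_Suc by (simp add: algebra_simps)
    have "1 = (real j + 1 / 2) * (2 * ?x / (2 + ?x))" using pos by (simp add: field_simps)
    also have "\<dots> \<le> (real j + 1 / 2) * ln (1 + ?x)"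
      by (intro mult_left_mono ln_one_plus_ge_pade) auto
    finally have 1: "0 \<le> g j - g (Suc j)" unfolding diff by simp
    have "(real j + 1 / 2) * ln (1 + ?x) \<le> (real j + 1 / 2) * (?x * (2 + ?x) / (2 * (1 + ?x)))"
      by (intro mult_left_mono ln_one_plus_le_trapezoid) auto
    also have "\<dots> = 1 + 1 / (4 * real j) - 1 / (4 * real (Suc j))"
      using pos by (simp add: divide_simps) (simp add: algebra_simps)
    finally have 2: "g j - g (Suc j) \<le> 1 / (4 * real j) - 1 / (4 * real (Suc j))"
      unfolding diff by simp
    show ?thesis using 1 2 by linarith
  qed
  have "g j \<le> 1 \<and> 3 / 4 \<le> g j - 1 / (4 * j)"
    using assms
  proof (induction j rule: dec_induct)
    case base
    show ?case by (simp add: g_def)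
  next
    case (step j)
    then show ?case using monotone[of j] by linarith
  qed
  moreover have "0 \<le> 1 / (4 * real j)" by simp
  ultimately have "g j \<le> 1" "3 / 4 \<le> g j" by linarith+
  then show "(real j + 1 / 2) * ln j - j + 3 / 4 \<le> ln (fact j)"
    and "ln (fact j) \<le> (real j + 1 / 2) * ln j - j + 1"
    unfolding g_def by linarith+
qed

section \<open>Tails of the Poisson distribution\<close>

lemma power_div_fact_eq_exp:
  fixes t :: real
  assumes "0 < t"
  shows "t ^ j / fact j * exp (- t) = exp (real j * ln t - ln (fact j) - t)"
  using assms by (simp add: exp_diff exp_minus exp_of_nat_mult divide_inverse)

text \<open>
  Besides Stirling's lower bound for \<open>j!\<close>, this is \<open>ln y \<le> y - 1\<close> at \<open>y = et/j\<close>, which is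
  sharp for \<open>j\<close> near \<open>et\<close>.
\<close>

lemma poisson_pmf_le:
  fixes t :: real
  assumes t: "0 < t" and j: "1 \<le> j"
  shows "pmf (poisson_pmf t) j \<le> exp ((exp 1 - 1) * t - j) / sqrt j"
proof -
  have "ln (exp 1 * t / j) \<le> exp 1 * t / j - 1"
    using t j by (intro ln_le_minus_one) auto
  then have "real j * ln (exp 1 * t / j) \<le> real j * (exp 1 * t / j - 1)"
    by (intro mult_left_mono) auto
  then have tilt: "real j * (1 + ln t - ln j) \<le> exp 1 * t - j"
    using t j by (simp add: ln_div ln_mult algebra_simps)
  have "pmf (poisson_pmf t) j = exp (real j * ln t - ln (fact j) - t)"
    using power_div_fact_eq_exp[OF t, of j] t by simp
  also have "\<dots> \<le> exp ((exp 1 - 1) * t - j - ln j / 2)"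
    using ln_fact_bounds(1)[OF j] tilt by (simp add: algebra_simps)
  also have "\<dots> = exp ((exp 1 - 1) * t - j) / sqrt j"
    using j by (simp add: exp_diff ln_sqrt[symmetric])
  finally show ?thesis .
qed

text \<open>
  The pointwise bound decays geometrically with ratio \<open>1/e\<close> beyond \<open>a\<close>, so summing it costs only a
  constant.  The factor \<open>1/\<surd>a\<close> cannot be dropped: it cancels the term \<open>- ln L / 2\<close> of
  the centering.  The maximum with 1 lets the bound hold for small and negative levels too, where
  it follows from probabilities being at most 1.
\<close>

lemma poisson_tail_le:
  fixes t a :: real
  assumes t: "0 < t"
  shows "measure_pmf.prob (poisson_pmf t) {j. a \<le> real j}
    \<le> 3 * exp ((exp 1 - 1) * t - a) / sqrt (max 1 a)"
proof (cases "a \<le> 1")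
  case True
  have "1 \<le> 3 * exp (- 1 :: real)" using exp_le by (simp add: exp_minus field_simps)
  also have "exp (- 1) \<le> exp ((exp 1 - 1) * t - a)"
  proof -
    have "0 \<le> (exp 1 - 1) * t" using t by simp
    then show ?thesis using True by simp
  qed
  finally have "1 \<le> 3 * exp ((exp 1 - 1) * t - a)" by simp
  with measure_pmf.prob_le_1[of "poisson_pmf t" "{j. a \<le> real j}"]
  have "measure_pmf.prob (poisson_pmf t) {j. a \<le> real j} \<le> 3 * exp ((exp 1 - 1) * t - a)"
    by (rule order_trans)
  then show ?thesis using True by simp
next
  case False
  define r where "r = nat \<lceil>a\<rceil>"
  have r: "a \<le> real r" "1 \<le> r" using False unfolding r_def by linarith+
  let ?b = "exp ((exp 1 - 1) * t - a) / sqrt a"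
  have point: "pmf (poisson_pmf t) (r + i) \<le> ?b * exp (- 1) ^ i" for i
  proof -
    have "pmf (poisson_pmf t) (r + i) \<le> exp ((exp 1 - 1) * t - (r + i)) / sqrt (r + i)"
      using r by (intro order_trans[OF poisson_pmf_le[OF t]]) auto
    also have "\<dots> \<le> exp ((exp 1 - 1) * t - (a + i)) / sqrt a"
      using r False by (intro frac_le) auto
    also have "\<dots> = ?b * exp (- 1) ^ i"
      by (simp add: exp_of_nat_mult[symmetric] exp_add[symmetric] algebra_simps)
    finally show ?thesis .
  qed
  have q: "exp (- 1 :: real) < 1" by simp
  have sums: "(\<lambda>i. ?b * exp (- 1 :: real) ^ i) sums (?b * (1 / (1 - exp (- 1))))"
    by (intro sums_mult geometric_sums) simp
  have "{j. a \<le> real j} = (\<Union>i. {r + i})"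
  proof (intro equalityI subsetI)
    fix j assume "j \<in> {j. a \<le> real j}"
    then have "r \<le> j" unfolding r_def by (simp add: nat_le_iff ceiling_le_iff)
    then show "j \<in> (\<Union>i. {r + i})" using le_Suc_ex by blast
  qed (use r in auto)
  then have "measure_pmf.prob (poisson_pmf t) {j. a \<le> real j}
      = measure_pmf.prob (poisson_pmf t) (\<Union>i. {r + i})" by simp
  also have "\<dots> \<le> (\<Sum>i. measure_pmf.prob (poisson_pmf t) {r + i})"
  proof (rule measure_pmf.finite_measure_subadditive_countably)
    show "summable (\<lambda>i. measure_pmf.prob (poisson_pmf t) {r + i})"
      by (rule summable_comparison_test'[OF sums_summable[OF sums]])
        (use point in \<open>simp add: measure_pmf_single\<close>)
  qed auto
  also have "\<dots> \<le> (\<Sum>i. ?b * exp (- 1) ^ i)"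
    by (rule suminf_le[OF _ _ sums_summable[OF sums]],
        use point in \<open>simp add: measure_pmf_single\<close>,
        rule summable_comparison_test'[OF sums_summable[OF sums]],
        use point in \<open>simp add: measure_pmf_single\<close>)
  also have "\<dots> = ?b * (1 / (1 - exp (- 1)))" using sums by (rule sums_unique[symmetric])
  also have "\<dots> \<le> ?b * 3"
  proof (intro mult_left_mono)
    have "(2::real) \<le> exp 1" using exp_ge_add_one_self[of 1] by simp
    then show "1 / (1 - exp (- 1)) \<le> (3 :: real)" by (simp add: exp_minus field_simps)
  qed (use False in auto)
  finally show ?thesis using False by (simp add: max_def mult.commute)
qed

text \<open>
  The partial exponential sum is dominated termwise by the binomial expansion of \<open>(1 + t)\<^sup>m\<close>.
\<close>

lemma poisson_lower_tail_le:
  fixes t :: real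
  assumes t: "0 < t"
  shows "measure_pmf.prob (poisson_pmf t) {..m} \<le> exp (- t) * (1 + t) ^ m"
proof -
  have "measure_pmf.prob (poisson_pmf t) {..m} = (\<Sum>j\<le>m. t ^ j / fact j * exp (- t))"
    using t by (simp add: measure_measure_pmf_finite)
  also have "\<dots> \<le> (\<Sum>j\<le>m. real (m choose j) * t ^ j * exp (- t))"
  proof (intro sum_mono mult_right_mono)
    fix j assume "j \<in> {..m}"
    then have "1 \<le> m choose j" by (simp add: Suc_leI)
    then have "1 \<le> real (m choose j)" by linarith
    moreover have "1 \<le> (fact j :: real)" by (rule fact_ge_1)
    ultimately have "1 \<le> real (m choose j) * fact j"
      using mult_mono[of 1 "real (m choose j)" 1 "fact j"] by simp
    then have "1 * t ^ j \<le> (real (m choose j) * fact j) * t ^ j"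
      using t by (intro mult_right_mono) auto
    then show "t ^ j / fact j \<le> real (m choose j) * t ^ j"
      by (simp add: field_simps)
  qed auto
  also have "\<dots> = exp (- t) * (t + 1) ^ m"
    unfolding binomial_ring by (simp add: sum_distrib_left mult_ac)
  finally show ?thesis by (simp add: add.commute)
qed

text \<open>
  The converse of \<open>poisson_pmf_le\<close>: here \<open>ln y \<le> y - 1\<close> is used at \<open>y = j/(et)\<close>, and the price is the
  quadratic error \<open>(et - j)\<^sup>2 / (et)\<close>.
\<close>

lemma poisson_pmf_ge:
  fixes t :: real
  assumes t: "0 < t" and j: "1 \<le> j"
  shows "exp ((exp 1 - 1) * t - j - (exp 1 * t - j)\<^sup>2 / (exp 1 * t) - ln j / 2 - 1)
    \<le> pmf (poisson_pmf t) j"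
proof -
  let ?c = "exp 1 * t"
  have c: "0 < ?c" using t by simp
  have "ln (j / ?c) \<le> j / ?c - 1"
    using c j by (intro ln_le_minus_one) auto
  then have "real j * ln (j / ?c) \<le> real j * (j / ?c - 1)"
    by (intro mult_left_mono) auto
  also have "real j * (j / ?c - 1) = - (?c - j) + (?c - j)\<^sup>2 / ?c"
  proof -
    have "real j * (j / c - 1) = - (c - j) + (c - j)\<^sup>2 / c" if "0 < c" for c :: real
      using that by (simp add: field_simps power2_eq_square)
    then show ?thesis using c by blast
  qed
  finally have tilt: "?c - j - (?c - j)\<^sup>2 / ?c \<le> real j * (1 + ln t - ln j)"
    using t j by (simp add: ln_div ln_mult algebra_simps)
  have "exp ((exp 1 - 1) * t - j - (?c - j)\<^sup>2 / ?c - ln j / 2 - 1)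
      \<le> exp (real j * ln t - ln (fact j) - t)"
    using ln_fact_bounds(2)[OF j] tilt by (simp add: algebra_simps)
  also have "\<dots> = pmf (poisson_pmf t) j"
    using power_div_fact_eq_exp[OF t, of j] t by simp
  finally show ?thesis .
qed

section \<open>Order statistics\<close>

lemma sorted_eq_filter_append:
  fixes ys :: "'a :: linorder list"
  assumes "sorted ys"
  shows "ys = filter (\<lambda>y. y \<le> r) ys @ filter (\<lambda>y. r < y) ys"
  using assms
proof (induction ys)
  case (Cons y ys)
  show ?case
  proof (cases "y \<le> r")
    case True
    then show ?thesis using Cons by (simp add: leD)
  next
    case False
    then have "\<forall>z\<in>set ys. r < z" using Cons.prems by auto
    then have "filter (\<lambda>z. r < z) ys = ys" "filter (\<lambda>z. z \<le> r) ys = []"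
      by (auto simp: filter_id_conv filter_empty_conv leD)
    then show ?thesis using False by (simp add: not_le)
  qed
qed simp

text \<open>
  This turns statements about order statistics into statements about the number of
  processes above a level, to which independence applies.
\<close>

lemma order_stat_gt_iff:
  assumes i: "1 \<le> i" "i \<le> n"
  shows "r < order_stat P n i t \<omega> \<longleftrightarrow> i \<le> card {j \<in> {1..n}. r < P j t \<omega>}"
proof -
  define xs where "xs = map (\<lambda>j. P j t \<omega>) [1..<Suc n]"
  define lo hi where "lo = filter (\<lambda>y. y \<le> r) (sort xs)" and "hi = filter (\<lambda>y. r < y) (sort xs)"
  have split: "sort xs = lo @ hi"
    unfolding lo_def hi_def by (rule sorted_eq_filter_append) simp
  have len: "length lo + length hi = n"
    using arg_cong[OF split, of length] by (simp add: xs_def del: upt_Suc)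
  have "mset hi = mset (filter (\<lambda>y. r < y) xs)" by (simp add: hi_def)
  then have "length hi = length (filter (\<lambda>y. r < y) xs)" by (metis size_mset)
  also have "\<dots> = length (filter (\<lambda>j. r < P j t \<omega>) [1..<Suc n])"
    by (simp add: xs_def filter_map comp_def del: upt_Suc)
  also have "\<dots> = card {j \<in> {1..n}. r < P j t \<omega>}"
    by (subst distinct_length_filter) (auto intro!: arg_cong[where f = card])
  finally have hi: "length hi = card {j \<in> {1..n}. r < P j t \<omega>}" .
  have "order_stat P n i t \<omega> = (lo @ hi) ! (n - i)"
    unfolding order_stat_def xs_def[symmetric] split[symmetric]
    using i by (subst rev_nth) (auto simp: xs_def simp del: upt_Suc)
  moreover have "r < (lo @ hi) ! (n - i) \<longleftrightarrow> i \<le> length hi"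
  proof (cases "i \<le> length hi")
    case True
    then have "(lo @ hi) ! (n - i) = hi ! (n - i - length lo)" "n - i - length lo < length hi"
      using len i by (auto simp: nth_append)
    then have "(lo @ hi) ! (n - i) \<in> set hi" by simp
    then show ?thesis using True by (simp add: hi_def)
  next
    case False
    then have "(lo @ hi) ! (n - i) = lo ! (n - i)" "n - i < length lo"
      using len i by (auto simp: nth_append)
    then have "(lo @ hi) ! (n - i) \<in> set lo" by simp
    then show ?thesis using False by (simp add: lo_def)
  qed
  ultimately show ?thesis by (simp add: hi)
qed

section \<open>Comparing the stopping time with a fixed time\<close>

context iid_unit_poisson_processes
begin

lemma prob_at_time:
  assumes "1 \<le> j" "0 < t"
  shows "prob {\<omega> \<in> space M. P j t \<omega> \<in> S} = measure_pmf.prob (poisson_pmf t) S"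
proof -
  interpret N: unit_poisson_process M "P j" using unit_poisson assms(1) .
  have [measurable]: "P j t \<in> measurable M (count_space UNIV)"
    "P j 0 \<in> measurable M (count_space UNIV)"
    using assms by (auto intro: measurable_P)
  have "measure_pmf.prob (poisson_pmf t) S
      = measure (distr M (count_space UNIV) (\<lambda>\<omega>. P j t \<omega> - P j 0 \<omega>)) S"
    using N.poisson_increments[of 0 t] assms(2) by simp
  also have "\<dots> = prob ((\<lambda>\<omega>. P j t \<omega> - P j 0 \<omega>) -` S \<inter> space M)"
    by (rule measure_distr) auto
  also have "(\<lambda>\<omega>. P j t \<omega> - P j 0 \<omega>) -` S \<inter> space M = {\<omega> \<in> space M. P j t \<omega> \<in> S}"
    using N.start_zero by auto
  finally show ?thesis by simp
qed

lemma sets_at_time: "1 \<le> j \<Longrightarrow> 0 \<le> t \<Longrightarrow> {\<omega> \<in> space M. P j t \<omega> \<in> S} \<in> events"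
  using measurable_P[of j t] by measurable

lemma sets_Ex_at_time:
  fixes n :: nat
  shows "0 \<le> t \<Longrightarrow> (\<Union>j\<in>{1..n}. {\<omega> \<in> space M. P j t \<omega> \<in> S}) \<in> events"
  by (intro sets.finite_UN sets_at_time) auto

lemma prob_Ex_at_time_le:
  fixes n :: nat
  assumes "0 < t"
  shows "prob (\<Union>j\<in>{1..n}. {\<omega> \<in> space M. P j t \<omega> \<in> S})
    \<le> n * measure_pmf.prob (poisson_pmf t) S"
proof -
  have "prob (\<Union>j\<in>{1..n}. {\<omega> \<in> space M. P j t \<omega> \<in> S})
      \<le> (\<Sum>j\<in>{1..n}. prob {\<omega> \<in> space M. P j t \<omega> \<in> S})"
    using assms by (intro finite_measure_subadditive_finite) (auto intro: sets_at_time)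
  also have "\<dots> = n * measure_pmf.prob (poisson_pmf t) S"
    using assms by (simp add: prob_at_time)
  finally show ?thesis .
qed

lemma indep_at_time:
  assumes "0 \<le> t"
  shows "indep_vars (\<lambda>_. count_space UNIV) (\<lambda>j. P j t) {1..}"
proof -
  have "indep_vars (\<lambda>_. count_space UNIV)
      (\<lambda>j \<omega>. (\<lambda>f. f t) ((\<lambda>j \<omega>. \<lambda>t\<in>{0..}. P j t \<omega>) j \<omega>)) {1..}"
    using assms by (intro indep_vars_compose2[OF independent_processes] measurable_component_singleton) simp
  then show ?thesis using assms by simp
qed

text \<open>
  A Chernoff bound at a single parameter: Markov's inequality for \<open>Z = 2\<^bsup>-N\<^esup>\<close>, where \<open>N\<close> is the number
  of indices with \<open>P j t \<in> S\<close>.  By independence \<open>Z\<close> has expectation \<open>(1 - q/2)\<^sup>n \<le> e\<^bsup>-nq/2\<^esup>\<close>, where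
  \<open>q\<close> is the probability of \<open>S\<close>.
\<close>

lemma prob_few_at_time_bound:
  fixes n k :: nat
  assumes t: "0 < t" and p: "p \<le> n * measure_pmf.prob (poisson_pmf t) S"
  shows "{\<omega> \<in> space M. card {j \<in> {1..n}. P j t \<omega> \<in> S} \<le> k} \<in> events"
    and "prob {\<omega> \<in> space M. card {j \<in> {1..n}. P j t \<omega> \<in> S} \<le> k} \<le> 2 ^ k * exp (- p / 2)"
proof -
  define q where "q = measure_pmf.prob (poisson_pmf t) S"
  define w where "w = (\<lambda>x::nat. if x \<in> S then 1 / 2 else 1 :: real)"
  define Z where "Z = (\<lambda>\<omega>. \<Prod>j\<in>{1..n}. w (P j t \<omega>))"
  have Z_eq: "Z \<omega> = (1 / 2) ^ card {j \<in> {1..n}. P j t \<omega> \<in> S}" for \<omega>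
    unfolding Z_def w_def by (simp add: prod.If_cases Int_def)
  have few: "card {j \<in> {1..n}. P j t \<omega> \<in> S} \<le> k \<longleftrightarrow> (1 / 2) ^ k \<le> Z \<omega>" for \<omega>
    unfolding Z_eq by (subst power_decreasing_iff) auto
  have indep: "indep_vars (\<lambda>_. borel) (\<lambda>j \<omega>. w (P j t \<omega>)) {1..n}"
    using t by (intro indep_vars_compose2[OF indep_vars_subset[OF indep_at_time]]) auto
  have w_meas: "(\<lambda>\<omega>. w (P j t \<omega>)) \<in> borel_measurable M" if "j \<in> {1..n}" for j
    using indep that by (auto simp: indep_vars_def)
  have w_int: "integrable M (\<lambda>\<omega>. w (P j t \<omega>))" if "j \<in> {1..n}" for j
    by (rule integrable_const_bound[where B = 1]) (auto simp: w_def intro: w_meas[OF that, unfolded w_def])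
  have w_exp: "(\<integral>\<omega>. w (P j t \<omega>) \<partial>M) = 1 - q / 2" if j: "j \<in> {1..n}" for j
  proof -
    let ?A = "{\<omega> \<in> space M. P j t \<omega> \<in> S}"
    have A: "?A \<in> events" using j t by (intro sets_at_time) auto
    have "(\<integral>\<omega>. w (P j t \<omega>) \<partial>M) = (\<integral>\<omega>. 1 - indicator ?A \<omega> / 2 \<partial>M)"
      by (intro Bochner_Integration.integral_cong) (auto simp: w_def indicator_def)
    also have "\<dots> = 1 - prob ?A / 2"
      using A by (subst Bochner_Integration.integral_diff) (auto simp: prob_space intro!: integrable_divide integrable_real_indicator emeasure_finite less_top[THEN iffD1])
    finally show ?thesis using prob_at_time[of j t S] j t by (simp add: q_def)
  qed
  have Z_int: "integrable M Z"
    unfolding Z_def using indep w_int by (intro indep_vars_integrable) auto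
  then have [measurable]: "Z \<in> borel_measurable M" by auto
  show "{\<omega> \<in> space M. card {j \<in> {1..n}. P j t \<omega> \<in> S} \<le> k} \<in> events"
    unfolding few by measurable
  have "prob {\<omega> \<in> space M. card {j \<in> {1..n}. P j t \<omega> \<in> S} \<le> k}
      = prob {\<omega> \<in> space M. (1 / 2) ^ k \<le> Z \<omega>}"
    unfolding few ..
  also have "\<dots> \<le> (\<integral>\<omega>. Z \<omega> \<partial>M) / (1 / 2) ^ k"
    by (rule integral_Markov_inequality_measure[OF Z_int sets.empty_sets]) (auto simp: Z_eq)
  also have "(\<integral>\<omega>. Z \<omega> \<partial>M) = (1 - q / 2) ^ n"
    unfolding Z_def using indep w_int w_exp by (subst indep_vars_lebesgue_integral) auto
  also have "(1 - q / 2) ^ n \<le> exp (- q / 2) ^ n"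
    using exp_ge_add_one_self[of "- q / 2"]
      order_trans[OF measure_pmf.prob_le_1[of "poisson_pmf t" S], of 2]
    by (intro power_mono) (auto simp: q_def)
  also have "exp (- q / 2) ^ n = exp (- (n * q) / 2)"
    by (simp add: exp_of_nat_mult[symmetric])
  also have "\<dots> \<le> exp (- p / 2)" using p by (simp add: q_def)
  finally show "prob {\<omega> \<in> space M. card {j \<in> {1..n}. P j t \<omega> \<in> S} \<le> k} \<le> 2 ^ k * exp (- p / 2)"
    by (simp add: power_one_over divide_right_mono mult.commute)
qed

lemma prob_not_all_but_le:
  fixes n :: nat
  assumes t: "0 < t"
  shows "prob {\<omega> \<in> space M. \<not> all_but P m l n \<omega> t} \<le> n * (exp (- t) * (1 + t) ^ m)"
proof -
  have "{\<omega> \<in> space M. \<not> all_but P m l n \<omega> t} \<subseteq> (\<Union>j\<in>{1..n}. {\<omega> \<in> space M. P j t \<omega> \<in> {..m}})"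
  proof
    fix \<omega> assume "\<omega> \<in> {\<omega> \<in> space M. \<not> all_but P m l n \<omega> t}"
    then have "\<omega> \<in> space M" "{j \<in> {1..n}. \<not> P j t \<omega> > m} \<noteq> {}"
      unfolding all_but_def by (auto simp del: Collect_empty_eq)
    then show "\<omega> \<in> (\<Union>j\<in>{1..n}. {\<omega> \<in> space M. P j t \<omega> \<in> {..m}})" by force
  qed
  then have "prob {\<omega> \<in> space M. \<not> all_but P m l n \<omega> t}
      \<le> prob (\<Union>j\<in>{1..n}. {\<omega> \<in> space M. P j t \<omega> \<in> {..m}})"
    using t by (intro finite_measure_mono sets_Ex_at_time) auto
  also have "\<dots> \<le> n * measure_pmf.prob (poisson_pmf t) {..m}"
    by (rule prob_Ex_at_time_le[OF t])
  also have "\<dots> \<le> n * (exp (- t) * (1 + t) ^ m)"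
    by (intro mult_left_mono poisson_lower_tail_le t) auto
  finally show ?thesis .
qed

lemma sets_not_all_but: "0 \<le> t \<Longrightarrow> {\<omega> \<in> space M. \<not> all_but P m l n \<omega> t} \<in> events"
proof -
  assume "0 \<le> t"
  then have "space M - {\<omega> \<in> space M. all_but P m l n \<omega> t} \<in> events"
    by (intro sets.compl_sets sets_all_but)
  also have "space M - {\<omega> \<in> space M. all_but P m l n \<omega> t} = {\<omega> \<in> space M. \<not> all_but P m l n \<omega> t}"
    by auto
  finally show ?thesis .
qed

lemma P_mono:
  assumes "\<omega> \<in> space M" "1 \<le> j" "0 \<le> s" "s \<le> t"
  shows "P j s \<omega> \<le> P j t \<omega>"
  using mono_onD[OF unit_poisson_process.mono_paths[OF unit_poisson], of j \<omega> s t] assms by simp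

lemma order_stat_mono:
  assumes \<omega>: "\<omega> \<in> space M" and i: "1 \<le> i" "i \<le> n" and st: "0 \<le> s" "s \<le> t"
  shows "order_stat P n i s \<omega> \<le> order_stat P n i t \<omega>"
proof (rule ccontr)
  let ?r = "order_stat P n i t \<omega>"
  assume "\<not> ?thesis"
  then have "i \<le> card {j \<in> {1..n}. ?r < P j s \<omega>}"
    using order_stat_gt_iff[OF i] by (metis not_le)
  also have "\<dots> \<le> card {j \<in> {1..n}. ?r < P j t \<omega>}"
    using P_mono[OF \<omega> _ st] by (intro card_mono) (auto intro: less_le_trans)
  finally show False using order_stat_gt_iff[OF i, of ?r P t \<omega>] by simp
qed

text \<open>
  Either more than \<open>l\<close> stragglers are left at time \<open>t\<close>, hence at least one, or \<open>\<tau> \<le> t\<close> and then some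
  count already exceeds \<open>a\<close> at time \<open>t\<close>.
\<close>

lemma prob_order_stat_tau_gt_bound:
  assumes t: "0 < t" and i: "1 \<le> i" "i \<le> n"
  shows "prob {\<omega> \<in> space M. a < real (order_stat P n i (tau P m l n \<omega>) \<omega>)}
    \<le> n * (exp (- t) * (1 + t) ^ m) + n * measure_pmf.prob (poisson_pmf t) {j. a < real j}"
proof -
  let ?A = "{\<omega> \<in> space M. \<not> all_but P m l n \<omega> t}"
  let ?B = "\<Union>j\<in>{1..n}. {\<omega> \<in> space M. P j t \<omega> \<in> {j. a < real j}}"
  have A: "?A \<in> events" by (rule sets_not_all_but) (use t in simp)
  have B: "?B \<in> events" by (rule sets_Ex_at_time) (use t in simp)
  have "{\<omega> \<in> space M. a < real (order_stat P n i (tau P m l n \<omega>) \<omega>)} \<subseteq> ?A \<union> ?B"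
  proof
    fix \<omega> assume "\<omega> \<in> {\<omega> \<in> space M. a < real (order_stat P n i (tau P m l n \<omega>) \<omega>)}"
    then have \<omega>: "\<omega> \<in> space M" and a: "a < real (order_stat P n i (tau P m l n \<omega>) \<omega>)" by auto
    show "\<omega> \<in> ?A \<union> ?B"
    proof (cases "all_but P m l n \<omega> t")
      case True
      have "tau P m l n \<omega> \<le> t"
        using t True by (intro tau_is_minimum(3)[OF \<omega>]) (auto intro: exI[of _ t])
      then have "order_stat P n i (tau P m l n \<omega>) \<omega> \<le> order_stat P n i t \<omega>"
        by (intro order_stat_mono \<omega> i tau_nonneg)
      then have "a < real (order_stat P n i t \<omega>)" using a by linarith
      moreover have "order_stat P n i t \<omega> \<in> set (rev (sort (map (\<lambda>j. P j t \<omega>) [1..<Suc n])))"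
        unfolding order_stat_def using i by (intro nth_mem) auto
      ultimately show ?thesis using \<omega> by auto
    qed (use \<omega> in auto)
  qed
  then have "prob {\<omega> \<in> space M. a < real (order_stat P n i (tau P m l n \<omega>) \<omega>)} \<le> prob (?A \<union> ?B)"
    by (rule finite_measure_mono[OF _ sets.Un[OF A B]])
  also have "\<dots> \<le> prob ?A + prob ?B" by (rule measure_Un_le[OF A B])
  also have "\<dots> \<le> n * (exp (- t) * (1 + t) ^ m) + n * measure_pmf.prob (poisson_pmf t) {j. a < real j}"
    by (rule add_mono[OF prob_not_all_but_le[OF t] prob_Ex_at_time_le[OF t]])
  finally show ?thesis .
qed

text \<open>
  If at most \<open>l\<close> stragglers are left at time \<open>t\<close>, this is covered by the first term.  Otherwise
  \<open>\<tau> > t\<close>, and a small order statistic at \<open>\<tau>\<close> forces few leaders at time \<open>t\<close>.  The exception is the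
  null event on which no admissible time exists and \<open>\<tau> = 0\<close> by convention; it is contained in
  the event that more than \<open>l\<close> stragglers are left at time \<open>s\<close>, whose probability vanishes as \<open>s\<close>
  tends to infinity.
\<close>

lemma prob_order_stat_tau_le_bound:
  assumes t: "0 < t" and i: "1 \<le> i" "i \<le> n"
    and p: "p \<le> n * measure_pmf.prob (poisson_pmf t) {..m}"
    and q: "q \<le> n * measure_pmf.prob (poisson_pmf t) {j. a < real j}"
  shows "prob {\<omega> \<in> space M. real (order_stat P n i (tau P m l n \<omega>) \<omega>) \<le> a}
    \<le> 2 ^ l * exp (- p / 2) + 2 ^ i * exp (- q / 2)"
proof -
  let ?E = "{\<omega> \<in> space M. real (order_stat P n i (tau P m l n \<omega>) \<omega>) \<le> a}"
  let ?A = "{\<omega> \<in> space M. card {j \<in> {1..n}. P j t \<omega> \<in> {..m}} \<le> l}"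
  let ?B = "{\<omega> \<in> space M. card {j \<in> {1..n}. P j t \<omega> \<in> {j. a < real j}} \<le> i}"
  let ?R = "\<lambda>s. {\<omega> \<in> space M. \<not> all_but P m l n \<omega> s}"
  have A: "?A \<in> events" by (rule prob_few_at_time_bound(1)[OF t p])
  have B: "?B \<in> events" by (rule prob_few_at_time_bound(1)[OF t q])
  have bound: "prob ?E \<le> 2 ^ l * exp (- p / 2) + 2 ^ i * exp (- q / 2) + n * (exp (- s) * (1 + s) ^ m)"
    if s: "0 < s" for s
  proof -
    have R: "?R s \<in> events" using s by (intro sets_not_all_but) auto
    have "?E \<subseteq> ?A \<union> ?B \<union> ?R s"
    proof
      fix \<omega> assume "\<omega> \<in> ?E"
      then have \<omega>: "\<omega> \<in> space M" and a: "real (order_stat P n i (tau P m l n \<omega>) \<omega>) \<le> a" by auto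
      show "\<omega> \<in> ?A \<union> ?B \<union> ?R s"
      proof (cases "all_but P m l n \<omega> s")
        case True
        then have ex: "\<exists>s\<ge>0. all_but P m l n \<omega> s" using s by (intro exI[of _ s]) auto
        show ?thesis
        proof (cases "tau P m l n \<omega> \<le> t")
          case True
          then have "all_but P m l n \<omega> t"
            using all_but_mono[OF \<omega> tau_is_minimum(1)[OF \<omega> ex] True tau_is_minimum(2)[OF \<omega> ex]] by simp
          then have "\<omega> \<in> ?A" using \<omega> by (simp add: all_but_def not_less)
          then show ?thesis by blast
        next
          case False
          then have "order_stat P n i t \<omega> \<le> order_stat P n i (tau P m l n \<omega>) \<omega>"
            using t by (intro order_stat_mono \<omega> i) auto
          then have "real (order_stat P n i t \<omega>) \<le> a" using a by linarith
          then have "{j \<in> {1..n}. P j t \<omega> \<in> {j. a < real j}}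
              \<subseteq> {j \<in> {1..n}. order_stat P n i t \<omega> < P j t \<omega>}" by auto
          then have "card {j \<in> {1..n}. P j t \<omega> \<in> {j. a < real j}}
              \<le> card {j \<in> {1..n}. order_stat P n i t \<omega> < P j t \<omega>}" by (intro card_mono) auto
          also have "\<dots> < i"
            using order_stat_gt_iff[OF i, of "order_stat P n i t \<omega>" P t \<omega>] by simp
          finally show ?thesis using \<omega> by simp
        qed
      qed (use \<omega> in auto)
    qed
    then have "prob ?E \<le> prob (?A \<union> ?B \<union> ?R s)"
      by (rule finite_measure_mono[OF _ sets.Un[OF sets.Un[OF A B] R]])
    also have "\<dots> \<le> prob (?A \<union> ?B) + prob (?R s)"
      by (rule measure_Un_le[OF sets.Un[OF A B] R])
    also have "\<dots> \<le> (prob ?A + prob ?B) + prob (?R s)"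
      by (rule add_right_mono[OF measure_Un_le[OF A B]])
    also have "\<dots> \<le> (2 ^ l * exp (- p / 2) + 2 ^ i * exp (- q / 2)) + n * (exp (- s) * (1 + s) ^ m)"
      by (rule add_mono[OF add_mono[OF prob_few_at_time_bound(2)[OF t p] prob_few_at_time_bound(2)[OF t q]]
            prob_not_all_but_le[OF s]])
    finally show ?thesis .
  qed
  have "((\<lambda>s. 2 ^ l * exp (- p / 2) + 2 ^ i * exp (- q / 2) + n * (exp (- s) * (1 + s) ^ m))
      \<longlongrightarrow> 2 ^ l * exp (- p / 2) + 2 ^ i * exp (- q / 2)) at_top"
  proof -
    have "((\<lambda>s::real. exp (- s) * (1 + s) ^ m) \<longlongrightarrow> 0) at_top" by real_asymp
    from tendsto_add[OF tendsto_const tendsto_mult_right_zero[OF this, of "real n"],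
        of "2 ^ l * exp (- p / 2) + 2 ^ i * exp (- q / 2)"]
    show ?thesis by simp
  qed
  then show ?thesis
    by (rule tendsto_lowerbound)
      (rule eventually_mono[OF eventually_gt_at_top[of 0] bound], simp_all)
qed

end

section \<open>The centering sequence\<close>

definition centering_offset :: "nat \<Rightarrow> real" where
  "centering_offset m = ln ((exp 1 - 1) * fact m powr (exp 1 - 1) * sqrt (2 * pi * exp 1))"

lemma centering_a_eq:
  "centering_a m n = exp 1 * ln n + ((exp 1 - 1) * m - 1 / 2) * ln (ln n) - centering_offset m"
  by (simp add: centering_a_def centering_offset_def)

lemma ln_ge_half:
  assumes "2 \<le> (n::nat)"
  shows "1 / 2 \<le> ln (real n)"
proof -
  have "ln (1 / real n) \<le> 1 / real n - 1" using assms by (intro ln_le_minus_one) auto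
  moreover have "ln (1 / real n) = - ln (real n)" using assms by (simp add: ln_div)
  moreover have "1 / real n \<le> 1 / 2" using assms by (simp add: field_simps)
  ultimately show ?thesis by linarith
qed

text \<open>
  The tail bound at level \<open>a\<close> carries a factor \<open>1/\<surd>(max 1 a)\<close>; this lemma compares it with \<open>1/\<surd>L\<close> for
  every \<open>n \<ge> 2\<close>, including the small \<open>n\<close> for which \<open>ln L\<close> or \<open>a\<close> is negative.
\<close>

lemma ln_le_centering_a:
  "\<exists>K>0. \<forall>n\<ge>2. ln (real n) \<le> K * max 1 (centering_a m n)"
proof -
  define \<alpha> where "\<alpha> = (exp 1 - 1) * real m - 1 / 2"
  define A where "A = \<bar>\<alpha>\<bar> + 1"
  \<comment> \<open>Since A ln L \<le> L + A ln A, the term \<alpha> ln L of the centering costs at most L plus a constant.\<close>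
  define K where "K = \<bar>A * ln A + A + centering_offset m\<bar>"
  have A: "1 \<le> A" by (simp add: A_def)
  have "ln (real n) \<le> (1 + K) * max 1 (centering_a m n)" if n: "2 \<le> n" for n
  proof -
    define L where "L = ln (real n)"
    have L: "1 / 2 \<le> L" unfolding L_def by (rule ln_ge_half[OF n])
    have up: "A * ln L \<le> L + A * ln A"
    proof -
      have "ln (L / A) \<le> L / A - 1" using L A by (intro ln_le_minus_one) auto
      then have "ln L \<le> L / A + ln A" using L A by (simp add: ln_div)
      then have "A * ln L \<le> A * (L / A + ln A)" using A by (intro mult_left_mono) auto
      then show ?thesis using A by (simp add: algebra_simps)
    qed
    have low: "- 1 \<le> ln L"
    proof -
      have "ln (1 / L) \<le> 1 / L - 1" using L by (intro ln_le_minus_one) auto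
      moreover have "1 / L \<le> 2" using L by (simp add: field_simps)
      ultimately show ?thesis using L by (simp add: ln_div)
    qed
    have "\<bar>\<alpha> * ln L\<bar> \<le> A * \<bar>ln L\<bar>"
      unfolding abs_mult by (intro mult_right_mono) (auto simp: A_def)
    also have "\<dots> \<le> L + A * ln A + A"
    proof (cases "0 \<le> ln L")
      case False
      then have "A * \<bar>ln L\<bar> \<le> A * 1" using low A by (intro mult_left_mono) auto
      moreover have "0 \<le> A * ln A" using A by simp
      ultimately show ?thesis using L by linarith
    qed (use up A in auto)
    finally have "- (L + A * ln A + A) \<le> \<alpha> * ln L" by linarith
    moreover have "2 * L \<le> exp 1 * L"
      using L exp_ge_add_one_self[of "1::real"] by (intro mult_right_mono) auto
    ultimately have "L - K \<le> centering_a m n"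
      unfolding centering_a_eq L_def[symmetric] \<alpha>_def[symmetric] K_def by linarith
    then have "L \<le> K + centering_a m n" by linarith
    also have "\<dots> \<le> K * max 1 (centering_a m n) + 1 * max 1 (centering_a m n)"
    proof (rule add_mono)
      have "K * 1 \<le> K * max 1 (centering_a m n)" by (intro mult_left_mono) (auto simp: K_def)
      then show "K \<le> K * max 1 (centering_a m n)" by simp
    qed auto
    also have "\<dots> = (1 + K) * max 1 (centering_a m n)" by (simp add: algebra_simps)
    finally show ?thesis by (simp add: L_def)
  qed
  moreover have "0 < 1 + K" by (simp add: K_def add_pos_nonneg)
  ultimately show ?thesis by blast
qed

lemma eventually_centering_a_bounds:
  "\<forall>\<^sub>F n in sequentially. 1 \<le> ln (ln (real n)) \<and> (ln (ln (real n)))\<^sup>2 \<le> ln (real n)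
     \<and> 1 \<le> ln (real n) \<and> 3 / 2 * ln (real n) \<le> centering_a m n \<and> centering_a m n \<le> 4 * ln (real n) - 1"
proof -
  define \<alpha> \<kappa> where "\<alpha> = (exp 1 - 1) * real m - 1 / 2" and "\<kappa> = centering_offset m"
  have e: "2 \<le> exp (1::real)" "exp 1 \<le> (3::real)"
    using exp_ge_add_one_self[of "1::real"] exp_le by auto
  have "((\<lambda>n. (\<alpha> * ln (ln (real n)) - \<kappa>) / ln (real n)) \<longlongrightarrow> 0) sequentially" by real_asymp
  from tendstoD[OF this, of "1 / 2"]
  have "\<forall>\<^sub>F n in sequentially. dist ((\<alpha> * ln (ln (real n)) - \<kappa>) / ln (real n)) 0 < 1 / 2" by simp
  moreover have "\<forall>\<^sub>F n in sequentially. 1 \<le> ln (ln (real n))" by real_asymp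
  moreover have "\<forall>\<^sub>F n in sequentially. (ln (ln (real n)))\<^sup>2 \<le> ln (real n)" by real_asymp
  moreover have "\<forall>\<^sub>F n in sequentially. 2 \<le> ln (real n)" by real_asymp
  ultimately show ?thesis
  proof eventually_elim
    case (elim n)
    have "\<bar>\<alpha> * ln (ln (real n)) - \<kappa>\<bar> \<le> ln (real n) / 2"
      using elim by (simp add: dist_real_def abs_divide field_simps)
    moreover have "2 * ln (real n) \<le> exp 1 * ln (real n)" "exp 1 * ln (real n) \<le> 3 * ln (real n)"
      using e elim by (auto intro!: mult_right_mono)
    ultimately show ?case
      using elim unfolding centering_a_eq \<alpha>_def[symmetric] \<kappa>_def[symmetric] abs_le_iff by linarith
  qed
qed

section \<open>The upper tail\<close>

text \<open>
  The shift \<open>k/e\<close> balances stragglers against leaders.  With \<open>ln (1 + L)\<close> instead of \<open>ln L\<close> the time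
  is positive for all \<open>n \<ge> 2\<close>, and for these \<open>n\<close> the two logarithms differ by a bounded amount.
\<close>

definition late_time :: "nat \<Rightarrow> nat \<Rightarrow> nat \<Rightarrow> real" where
  "late_time m n k = ln n + m * ln (1 + ln n) + k / exp 1"

lemma late_time_pos: "2 \<le> n \<Longrightarrow> 0 < late_time m n k"
  using ln_ge_half[of n] unfolding late_time_def
  by (intro add_pos_nonneg) auto

text \<open>
  By the choice of the time, \<open>n e\<^bsup>-t\<^esup> = (1 + L)\<^bsup>-m\<^esup> e\<^bsup>-k/e\<^esup>\<close>, and \<open>1 + t\<close> is at most
  \<open>(1 + m) (1 + L) (1 + k)\<close>, so the powers of \<open>1 + L\<close> cancel.
\<close>

lemma late_time_straggler_bound:
  assumes n: "2 \<le> n"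
  shows "real n * (exp (- late_time m n k) * (1 + late_time m n k) ^ m)
    \<le> (1 + real m) ^ m * ((1 + real k) ^ m * exp (- real k / exp 1))"
proof -
  define L x where "L = ln (real n)" and "x = k / exp 1"
  have L: "1 / 2 \<le> L" unfolding L_def by (rule ln_ge_half[OF n])
  have nL: "real n = exp L" using n by (simp add: L_def)
  have "real k / exp 1 \<le> real k / 1" by (rule divide_left_mono) auto
  then have x: "0 \<le> x" "x \<le> k" by (auto simp: x_def)
  have t: "late_time m n k = L + m * ln (1 + L) + x" by (simp add: late_time_def L_def x_def)
  have "real m * ln (1 + L) \<le> real m * L"
    using L by (intro mult_left_mono ln_add_one_self_le_self) auto
  moreover have "0 \<le> real m * ln (1 + L)" using L by simp
  ultimately have t01: "0 \<le> 1 + late_time m n k" "1 + late_time m n k \<le> 1 + L + m * L + x"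
    using L x unfolding t by linarith+
  have "1 + L + m * L + x \<le> (1 + real m) * (1 + L) * (1 + x)"
  proof -
    have "0 \<le> m * x + L * x + m * (L * x) + m" using L x by auto
    then show ?thesis by (simp add: algebra_simps)
  qed
  also have "\<dots> \<le> (1 + real m) * (1 + L) * (1 + real k)" using L x by (intro mult_left_mono) auto
  finally have "(1 + late_time m n k) ^ m \<le> ((1 + real m) * (1 + L) * (1 + real k)) ^ m"
    using t01 by (intro power_mono) auto
  then have "exp (- (m * ln (1 + L)) - x) * (1 + late_time m n k) ^ m
      \<le> exp (- (m * ln (1 + L)) - x) * ((1 + real m) * (1 + L) * (1 + real k)) ^ m"
    by (intro mult_left_mono) auto
  also have "exp (- (m * ln (1 + L)) - x) * ((1 + real m) * (1 + L) * (1 + real k)) ^ m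
      = (1 + real m) ^ m * ((1 + real k) ^ m * exp (- x))"
  proof -
    have "exp (- (m * ln (1 + L)) - x) = exp (- x) / (1 + L) ^ m"
      using L by (simp add: exp_diff exp_minus exp_of_nat_mult field_simps)
    then show ?thesis using L by (simp add: power_mult_distrib)
  qed
  also have "exp (- (m * ln (1 + L)) - x) = real n * exp (- late_time m n k)"
    unfolding t nL by (simp add: exp_add[symmetric])
  finally show ?thesis by (simp add: mult.assoc x_def)
qed

text \<open>
  In \<open>n e\<^bsup>(e-1)t - a - k\<^esup>\<close> all growing terms of \<open>a\<close> cancel except \<open>ln L / 2\<close>, which the factor
  \<open>1/\<surd>(max 1 (a + k))\<close> of the tail bound compensates.
\<close>

lemma late_time_leader_bound:
  "\<exists>C>0. \<forall>n\<ge>2. \<forall>k.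
    n * measure_pmf.prob (poisson_pmf (late_time m n k)) {j. centering_a m n + k < real j}
      \<le> C * exp (- real k / exp 1)"
proof -
  obtain K where K: "0 < K" "\<And>n. 2 \<le> n \<Longrightarrow> ln (real n) \<le> K * max 1 (centering_a m n)"
    using ln_le_centering_a[of m] by blast
  define \<kappa> where "\<kappa> = centering_offset m"
  define C where "C = 3 * sqrt K * exp (4 * real m + \<kappa>)"
  have "n * measure_pmf.prob (poisson_pmf (late_time m n k)) {j. centering_a m n + k < real j}
        \<le> C * exp (- real k / exp 1)" if n: "2 \<le> n" for n k :: nat
  proof -
    define L where "L = ln (real n)"
    have L: "1 / 2 \<le> L" unfolding L_def by (rule ln_ge_half[OF n])
    have nL: "real n = exp L" using n by (simp add: L_def)
    define t where "t = late_time m n k"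
    define a where "a = centering_a m n"
    have t: "0 < t" unfolding t_def by (rule late_time_pos[OF n])
    have "L \<le> K * max 1 a" using K(2)[OF n] by (simp add: L_def a_def)
    also have "\<dots> \<le> K * max 1 (a + k)" using K(1) by (intro mult_left_mono) auto
    finally have "sqrt L \<le> sqrt K * sqrt (max 1 (a + k))" by (simp add: real_sqrt_mult[symmetric])
    then have sqrt_le: "1 / sqrt (max 1 (a + k)) \<le> sqrt K / sqrt L"
      using L by (simp add: field_simps)
    have "ln (1 + L) \<le> ln (3 * L)" using L by simp
    also have "\<dots> = ln 3 + ln L" using L by (simp add: ln_mult)
    also have "ln 3 \<le> (2::real)" using ln_le_minus_one[of 3] by simp
    finally have ln_diff: "ln (1 + L) - ln L \<le> 2" by simp
    have e: "exp 1 - 1 \<le> (2::real)" "0 \<le> exp 1 - (1::real)" using exp_le by auto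
    have "(exp 1 - 1) * (m * (ln (1 + L) - ln L)) \<le> 2 * (real m * 2)"
    proof (rule mult_mono)
      have "ln L \<le> ln (1 + L)" using L by simp
      then show "0 \<le> m * (ln (1 + L) - ln L)" by simp
      show "m * (ln (1 + L) - ln L) \<le> real m * 2" using ln_diff by (intro mult_left_mono) auto
    qed (use e in auto)
    \<comment> \<open>The coefficient of k is (e - 1)/e - 1 = - 1/e.\<close>
    moreover have "L + ((exp 1 - 1) * t - (a + k))
        = (exp 1 - 1) * (m * (ln (1 + L) - ln L)) + ln L / 2 + \<kappa> - real k / exp 1"
      unfolding t_def a_def late_time_def centering_a_eq L_def[symmetric] \<kappa>_def[symmetric]
      by (simp add: field_simps)
    ultimately have expo: "L + ((exp 1 - 1) * t - (a + k)) \<le> 4 * real m + \<kappa> + ln L / 2 - real k / exp 1" by simp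
    have "n * measure_pmf.prob (poisson_pmf t) {j. a + k < real j}
        \<le> n * measure_pmf.prob (poisson_pmf t) {j. a + k \<le> real j}"
      by (intro mult_left_mono measure_pmf.finite_measure_mono) auto
    also have "\<dots> \<le> n * (3 * exp ((exp 1 - 1) * t - (a + k)) / sqrt (max 1 (a + k)))"
      by (intro mult_left_mono poisson_tail_le t) auto
    also have "\<dots> = 3 * exp (L + ((exp 1 - 1) * t - (a + k))) * (1 / sqrt (max 1 (a + k)))"
      unfolding nL exp_add by simp
    also have "\<dots> \<le> 3 * exp (4 * real m + \<kappa> + ln L / 2 - real k / exp 1) * (sqrt K / sqrt L)"
      using expo sqrt_le by (intro mult_mono) auto
    also have "\<dots> = C * exp (- real k / exp 1)"
    proof -
      have "exp (ln L / 2) = sqrt L" using L by (simp add: ln_sqrt[symmetric])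
      moreover have "exp (4 * real m + \<kappa> + ln L / 2 - real k / exp 1)
          = exp (4 * real m + \<kappa>) * exp (ln L / 2) * exp (- real k / exp 1)"
        unfolding exp_add[symmetric] by simp
      ultimately have "exp (4 * real m + \<kappa> + ln L / 2 - real k / exp 1)
          = exp (4 * real m + \<kappa>) * sqrt L * exp (- real k / exp 1)" by simp
      then show ?thesis using L by (simp add: C_def)
    qed
    finally show ?thesis by (simp add: t_def a_def)
  qed
  moreover have "0 < C" using K(1) by (simp add: C_def)
  ultimately show ?thesis by blast
qed

lemma polynomial_le_exp:
  fixes \<delta> :: real
  assumes "0 < \<delta>"
  shows "\<exists>D>0. \<forall>k::nat. (1 + real k) ^ m \<le> D * exp (\<delta> * k)"
proof -
  define c where "c = \<delta> / (m + 1)"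
  have c: "0 < c" using assms by (simp add: c_def)
  have "(1 + real k) ^ m \<le> (1 + 1 / c) ^ m * exp (\<delta> * k)" for k :: nat
  proof -
    have "0 \<le> c * k" using c by simp
    then have "c * k \<le> exp (c * k)" "1 \<le> exp (c * k)"
      using exp_ge_add_one_self[of "c * k"] by linarith+
    then have "1 + real k \<le> exp (c * k) + exp (c * k) / c" using c by (intro add_mono) (simp_all add: field_simps)
    also have "\<dots> = (1 + 1 / c) * exp (c * k)" by (simp add: distrib_right)
    finally have "1 + real k \<le> (1 + 1 / c) * exp (c * k)" .
    then have "(1 + real k) ^ m \<le> ((1 + 1 / c) * exp (c * k)) ^ m" by (intro power_mono) auto
    also have "\<dots> = (1 + 1 / c) ^ m * exp ((m * c) * k)"
      by (simp add: power_mult_distrib exp_of_nat_mult[symmetric] mult.assoc)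
    also have "\<dots> \<le> (1 + 1 / c) ^ m * exp (\<delta> * k)"
    proof -
      have "m * c \<le> \<delta>" using assms by (simp add: c_def field_simps)
      then show ?thesis using c by (intro mult_left_mono) (auto intro: mult_right_mono)
    qed
    finally show ?thesis .
  qed
  moreover have "0 < (1 + 1 / c) ^ m" using c by (simp add: add_pos_pos)
  ultimately show ?thesis by blast
qed

text \<open>
  The polynomial factor of the straggler term is the only loss beyond a constant, and
  \<open>e\<^bsup>\<epsilon>k/e\<^esup>\<close> dominates it.
\<close>

lemma order_stat_tau_upper_tail:
  fixes m l i :: nat and \<epsilon> :: real
  assumes i: "1 \<le> i" and \<epsilon>: "0 < \<epsilon>"
  shows "\<exists>C>0. \<forall>(M :: 'a measure) P n k.
    iid_unit_poisson_processes M P \<longrightarrow> i \<le> n \<longrightarrow> 2 \<le> n \<longrightarrow>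
      \<P>(\<omega> in M. int (order_stat P n i (tau P m l n \<omega>) \<omega>) - centering_b m n > int k)
        \<le> C * exp (- (1 - \<epsilon>) * real k / exp 1)"
proof -
  obtain C where C: "0 < C" "\<And>n k. 2 \<le> n \<Longrightarrow>
      n * measure_pmf.prob (poisson_pmf (late_time m n k)) {j. centering_a m n + k < real j}
        \<le> C * exp (- real k / exp 1)"
    using late_time_leader_bound[of m] by blast
  obtain D where D: "0 < D" "\<And>k::nat. (1 + real k) ^ m \<le> D * exp (\<epsilon> / exp 1 * k)"
    using polynomial_le_exp[of "\<epsilon> / exp 1" m] \<epsilon> by (auto simp del: times_divide_eq_left)
  define C' where "C' = ((1 + real m) ^ m + C) * D"
  show ?thesis
  proof (intro exI[of _ C'] conjI allI impI)
    show "0 < C'" using C(1) D(1) by (simp add: C'_def add_nonneg_pos)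
    fix M :: "'a measure" and P and n k :: nat
    assume "iid_unit_poisson_processes M P" and n: "i \<le> n" "2 \<le> n"
    then interpret iid_unit_poisson_processes M P by simp
    let ?M = "\<lambda>\<omega>. order_stat P n i (tau P m l n \<omega>) \<omega>"
    have ev: "{\<omega> \<in> space M. centering_a m n + k < real (?M \<omega>)} \<in> events"
      using measurable_order_stat_tau[OF i n(1)] by measurable
    have "int (?M \<omega>) - centering_b m n > int k \<Longrightarrow> centering_a m n + k < real (?M \<omega>)" for \<omega>
      unfolding centering_b_def by linarith
    then have "prob {\<omega> \<in> space M. int (?M \<omega>) - centering_b m n > int k}
        \<le> prob {\<omega> \<in> space M. centering_a m n + k < real (?M \<omega>)}"
      using ev by (intro finite_measure_mono) auto
    also have "\<dots> \<le> n * (exp (- late_time m n k) * (1 + late_time m n k) ^ m)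
        + n * measure_pmf.prob (poisson_pmf (late_time m n k)) {j. centering_a m n + k < real j}"
      by (intro prob_order_stat_tau_gt_bound late_time_pos n i)
    also have "\<dots> \<le> (1 + real m) ^ m * ((1 + real k) ^ m * exp (- real k / exp 1)) + C * exp (- real k / exp 1)"
      by (intro add_mono late_time_straggler_bound C(2) n)
    also have "\<dots> \<le> (1 + real m) ^ m * ((1 + real k) ^ m * exp (- real k / exp 1))
        + C * ((1 + real k) ^ m * exp (- real k / exp 1))"
      using C(1) one_le_power[of "1 + real k" m] by (intro add_left_mono mult_left_mono) auto
    also have "\<dots> = ((1 + real m) ^ m + C) * ((1 + real k) ^ m * exp (- real k / exp 1))"
      by (simp add: distrib_right)
    also have "\<dots> \<le> ((1 + real m) ^ m + C) * (D * exp (\<epsilon> / exp 1 * k) * exp (- real k / exp 1))"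
      using C(1) D(2)[of k] by (intro mult_left_mono mult_right_mono) auto
    also have "\<dots> = C' * exp (- (1 - \<epsilon>) * real k / exp 1)"
      by (simp add: C'_def mult.assoc exp_add[symmetric] field_simps)
    finally show "prob {\<omega> \<in> space M. int (?M \<omega>) - centering_b m n > int k}
      \<le> C' * exp (- (1 - \<epsilon>) * real k / exp 1)" .
  qed
qed

section \<open>The lower tail\<close>

text \<open>
  Any shift \<open>\<delta>k\<close> with small enough \<open>\<delta> > 0\<close> serves here; \<open>\<delta> = 1/4\<close> makes the expected numbers of
  stragglers and of leaders both of order at least \<open>e\<^bsup>k/4\<^esup>\<close>.
\<close>

definition early_time :: "nat \<Rightarrow> nat \<Rightarrow> nat \<Rightarrow> real" where
  "early_time m n k = ln n + m * ln (ln n) - k / 4"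

text \<open>
  The probability of exactly \<open>m\<close> jumps suffices.  Since \<open>t \<ge> L/2\<close>, the factor \<open>t\<^sup>m\<close> makes up for the
  \<open>L\<^bsup>-m\<^esup>\<close> in \<open>n e\<^bsup>-t\<^esup> = L\<^bsup>-m\<^esup> e\<^bsup>k/4\<^esup>\<close>.
\<close>

lemma early_time_straggler_bound:
  assumes n: "0 < n" "1 \<le> ln (real n)" and k: "8 * real k \<le> ln (real n)"
  shows "1 / (2 ^ m * fact m) * exp (k / 4)
    \<le> n * measure_pmf.prob (poisson_pmf (early_time m n k)) {..m}"
proof -
  define L t where "L = ln (real n)" and "t = early_time m n k"
  have nL: "real n = exp L" using n by (simp add: L_def)
  have L: "1 \<le> L" "8 * real k \<le> L" using assms by (auto simp: L_def)
  have t_eq: "t = L + m * ln L - k / 4" by (simp add: t_def early_time_def L_def)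
  have "0 \<le> m * ln L" using L by simp
  then have t: "L / 2 \<le> t" "0 < t" using L unfolding t_eq by linarith+
  have "L ^ m = exp (m * ln L)" using L by (simp add: exp_of_nat_mult)
  then have "exp (k / 4) = exp L * exp (- L - m * ln L + k / 4) * L ^ m"
    by (simp add: exp_add[symmetric])
  then have "1 / (2 ^ m * fact m) * exp (k / 4)
      = exp L * (exp (- L - m * ln L + k / 4) * (L / 2) ^ m / fact m)"
    by (simp add: power_divide)
  also have "\<dots> \<le> exp L * (exp (- t) * t ^ m / fact m)"
    using t L unfolding t_eq[symmetric]
    by (intro mult_left_mono divide_right_mono mult_mono power_mono) (auto simp: t_eq)
  also have "\<dots> = n * measure_pmf.prob (poisson_pmf t) {m}"
    using t by (simp add: nL measure_pmf_single)
  also have "\<dots> \<le> n * measure_pmf.prob (poisson_pmf t) {..m}"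
    by (intro mult_left_mono measure_pmf.finite_measure_mono) auto
  finally show ?thesis by (simp add: t_def)
qed

text \<open>
  Only the first value \<open>s = b - k + 1\<close> above the level is needed.  Its distance from \<open>et\<close> is at most
  \<open>D ln L + k\<close>, so for \<open>k \<le> L/8\<close> the quadratic error of \<open>poisson_pmf_ge\<close> is at most a constant plus
  \<open>k/4\<close>.  The linear part of the exponent contributes \<open>(1 - (e-1)/4) k \<ge> k/2\<close>, which leaves \<open>k/4\<close>.
\<close>

lemma early_time_leader_bound:
  fixes m n k :: nat
  defines "D \<equiv> m + 2 + \<bar>centering_offset m\<bar>"
  assumes n: "0 < n" and lnln: "1 \<le> ln (ln (real n))" "(ln (ln (real n)))\<^sup>2 \<le> ln (real n)"
    and L1: "1 \<le> ln (real n)"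
    and a: "3 / 2 * ln (real n) \<le> centering_a m n" "centering_a m n \<le> 4 * ln (real n) - 1"
    and k: "8 * real k \<le> ln (real n)"
  shows "exp (centering_offset m - 2 - 2 * D\<^sup>2 - ln 4 / 2) * exp (k / 4)
    \<le> n * measure_pmf.prob (poisson_pmf (early_time m n k)) {j. centering_b m n - real k < real j}"
proof -
  define L t \<kappa> s where "L = ln (real n)" and "t = early_time m n k" and "\<kappa> = centering_offset m"
    and "s = nat (centering_b m n - int k + 1)"
  have nL: "real n = exp L" using n by (simp add: L_def)
  note [simp] = L_def[symmetric] \<kappa>_def[symmetric]
  have L: "1 \<le> L" "8 * real k \<le> L" "1 \<le> ln L" "(ln L)\<^sup>2 \<le> L" using assms by auto
  have t_eq: "t = L + m * ln L - k / 4" by (simp add: t_def early_time_def)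
  have "0 \<le> m * ln L" using L by simp
  then have t: "L / 2 \<le> t" "0 < t" using L unfolding t_eq by linarith+
  have e: "2 \<le> exp (1::real)" "exp 1 \<le> (3::real)"
    using exp_ge_add_one_self[of "1::real"] exp_le by auto
  \<comment> \<open>The rounding in b shifts s by at most one from a - k.\<close>
  define \<theta> where "\<theta> = real_of_int (centering_b m n) - real k + 1 - (centering_a m n - k)"
  have \<theta>: "0 < \<theta>" "\<theta> \<le> 1" unfolding \<theta>_def centering_b_def by linarith+
  have "0 < centering_b m n - int k + 1"
  proof -
    have "0 < centering_a m n - k" using a(1) L by simp
    then have "0 < real_of_int (centering_b m n - int k + 1)"
      using \<theta>(1) unfolding \<theta>_def by simp
    then show ?thesis by linarith
  qed
  then have s: "real s = centering_a m n - k + \<theta>" "1 \<le> s"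
    by (auto simp: s_def \<theta>_def)
  have s4: "ln s \<le> ln 4 + ln L"
  proof -
    have "real s \<le> 4 * L" using a(2) \<theta> s by simp
    then have "ln s \<le> ln (4 * L)" using s by simp
    then show ?thesis using L by (simp add: ln_mult)
  qed
  let ?d = "exp 1 * t - s"
  have d_eq: "?d = (m + 1 / 2) * ln L + \<kappa> - \<theta> + (1 - exp 1 / 4) * k"
    unfolding t_eq s centering_a_eq by (simp add: algebra_simps)
  have "\<bar>?d\<bar> \<le> D * ln L + k"
  proof -
    define X Y where "X = (m + 1 / 2) * ln L" and "Y = (1 - exp 1 / 4) * real k"
    have X: "0 \<le> X" unfolding X_def using L by simp
    have Y: "0 \<le> Y" "Y \<le> k"
      using e mult_right_mono[of "1 - exp 1 / 4" 1 "real k"] by (auto simp: Y_def)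
    have "(\<bar>\<kappa>\<bar> + 3 / 2) * 1 \<le> (\<bar>\<kappa>\<bar> + 3 / 2) * ln L" using L by (intro mult_left_mono) auto
    also have "\<dots> = D * ln L - X" by (simp add: D_def X_def algebra_simps)
    finally have "\<bar>\<kappa>\<bar> + 3 / 2 \<le> D * ln L - X" by simp
    then show ?thesis unfolding d_eq X_def[symmetric] Y_def[symmetric] using X Y \<theta> by linarith
  qed
  then have "?d\<^sup>2 \<le> (D * ln L + k)\<^sup>2" by (metis abs_ge_zero power2_abs power_mono)
  also have "\<dots> \<le> 2 * (D * ln L)\<^sup>2 + 2 * (real k)\<^sup>2"
    using sum_squares_bound[of "D * ln L" "real k"] by (simp add: power2_sum)
  also have "\<dots> \<le> 2 * D\<^sup>2 * L + k / 4 * L"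
  proof (rule add_mono)
    show "2 * (D * ln L)\<^sup>2 \<le> 2 * D\<^sup>2 * L"
      using L by (simp add: power_mult_distrib mult_left_mono)
    have "real k * (8 * real k) \<le> real k * L" using L by (intro mult_left_mono) auto
    then show "2 * (real k)\<^sup>2 \<le> k / 4 * L" by (simp add: power2_eq_square)
  qed
  finally have "?d\<^sup>2 \<le> (2 * D\<^sup>2 + k / 4) * L" by (simp add: algebra_simps)
  also have "\<dots> \<le> (2 * D\<^sup>2 + k / 4) * (exp 1 * t)"
  proof (rule mult_left_mono)
    have "2 * (L / 2) \<le> exp 1 * t" using t e L by (intro mult_mono) auto
    then show "L \<le> exp 1 * t" by simp
  qed auto
  finally have quad: "?d\<^sup>2 / (exp 1 * t) \<le> 2 * D\<^sup>2 + k / 4"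
    using t by (simp add: divide_le_eq)
  have lin: "L + ((exp 1 - 1) * t - s) = ln L / 2 + \<kappa> - \<theta> + (1 - (exp 1 - 1) / 4) * k"
    unfolding t_eq s centering_a_eq by (simp add: algebra_simps)
  have "1 / 2 * real k \<le> (1 - (exp 1 - 1) / 4) * real k"
    using e by (intro mult_right_mono) auto
  then have "\<kappa> - 2 - 2 * D\<^sup>2 - ln 4 / 2 + k / 4
      \<le> L + ((exp 1 - 1) * t - s - ?d\<^sup>2 / (exp 1 * t) - ln s / 2 - 1)"
    using lin quad s4 \<theta> by linarith
  then have "exp (\<kappa> - 2 - 2 * D\<^sup>2 - ln 4 / 2) * exp (k / 4)
      \<le> exp L * exp ((exp 1 - 1) * t - s - ?d\<^sup>2 / (exp 1 * t) - ln s / 2 - 1)"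
    unfolding exp_add[symmetric] by simp
  also have "\<dots> \<le> exp L * pmf (poisson_pmf t) s"
    by (intro mult_left_mono poisson_pmf_ge t s) auto
  also have "\<dots> = n * measure_pmf.prob (poisson_pmf t) {s}"
    by (simp add: nL measure_pmf_single)
  also have "\<dots> \<le> n * measure_pmf.prob (poisson_pmf t) {j. centering_b m n - real k < real j}"
    using \<theta>(1) s(1) unfolding \<theta>_def
    by (intro mult_left_mono measure_pmf.finite_measure_mono) auto
  finally show ?thesis by (simp add: t_def)
qed

text \<open>
  The function \<open>f\<close> stands for the lower tail probabilities of a given \<open>n\<close>; quantifying over it makes the
  constants independent of the probability space.  For large \<open>n\<close> and \<open>k \<le> b n \<le> 4L\<close>, the point
  \<open>min k (L/8)\<close>, rounded down, is at least \<open>k/32 - 1\<close>, and \<open>f\<close> is antitone, so dividing the inner rate by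
  32 suffices.  For the finitely many small \<open>n\<close> only boundedly many \<open>k\<close> matter, and a large \<open>C\<close> covers
  these.
\<close>

lemma extend_double_exponential_bound:
  fixes b :: "nat \<Rightarrow> int" and c A :: real
  assumes c: "0 < c" and A: "0 < A" and b: "\<forall>n\<ge>N. b n \<le> 4 * ln (real n)"
    and L: "\<forall>n\<ge>N. 0 \<le> ln (real n)"
  shows "\<exists>C c1 c2. 0 < C \<and> 0 < c1 \<and> 0 < c2 \<and>
    (\<forall>n (f :: nat \<Rightarrow> real) k.
      antimono f \<longrightarrow> (\<forall>k. f k \<le> 1) \<longrightarrow> (\<forall>k. b n < int k \<longrightarrow> f k \<le> 0) \<longrightarrow>
      (N \<le> n \<longrightarrow> (\<forall>k. 8 * real k \<le> ln (real n) \<longrightarrow> f k \<le> A * exp (- c * exp (k / 4)))) \<longrightarrow>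
      f k \<le> C * exp (- c1 * exp (c2 * k)))"
proof -
  define B where "B = (\<Sum>n<N. nat (b n))"
  define c1 where "c1 = c * exp (- 1 / 4)"
  \<comment> \<open>The second summand makes the bound at least 1 for k \<le> B; for n < N, larger k exceed b n.\<close>
  define C where "C = A + exp (c1 * exp (1 / 128 * B))"
  have c1: "0 < c1" using c by (simp add: c1_def)
  have C: "0 < C" "A \<le> C" using A by (auto simp: C_def add_pos_pos)
  have bound: "f k \<le> C * exp (- c1 * exp (1 / 128 * k))"
    if f: "antimono f" "\<And>k. f k \<le> 1" "\<And>k. b n < int k \<Longrightarrow> f k \<le> 0"
      "\<And>k. N \<le> n \<Longrightarrow> 8 * real k \<le> ln (real n) \<Longrightarrow> f k \<le> A * exp (- c * exp (k / 4))"
    for n k and f :: "nat \<Rightarrow> real"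
  proof (cases "b n < int k")
    case True
    then show ?thesis using C by (intro order_trans[OF f(3)[OF True]]) simp
  next
    case kb: False
    show ?thesis
    proof (cases "N \<le> n")
      case True
      define r where "r = nat \<lfloor>ln (real n) / 8\<rfloor>"
      define k' where "k' = min k r"
      have "real k \<le> b n" using kb by linarith
      then have "real k \<le> 4 * ln (real n)" using b True by fastforce
      moreover have "ln (real n) / 8 - 1 \<le> real r" "real r \<le> ln (real n) / 8"
        using L[rule_format, OF True] unfolding r_def by linarith+
      ultimately have k': "k / 32 - 1 \<le> real k'" "8 * real k' \<le> ln (real n)" "k' \<le> k"
        by (auto simp: k'_def min_def)
      have "f k \<le> f k'" using f(1) k'(3) by (rule antimonoD)
      also have "\<dots> \<le> A * exp (- c * exp (k' / 4))" by (rule f(4)[OF True k'(2)])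
      also have "\<dots> \<le> A * exp (- c * exp (- 1 / 4 + 1 / 128 * k))"
        using A c k'(1) by (intro mult_left_mono) (auto intro!: mult_left_mono)
      also have "\<dots> \<le> C * exp (- c1 * exp (1 / 128 * k))"
        using C unfolding exp_add c1_def by (intro mult_mono) (auto simp: mult.assoc)
      finally show ?thesis .
    next
      case False
      have "nat (b n) \<le> B" unfolding B_def using False by (intro member_le_sum) auto
      then have "k \<le> B" using kb by linarith
      then have "exp (c1 * exp (1 / 128 * k)) \<le> C"
        using A c1 unfolding C_def by (intro add_increasing) auto
      then have "exp (c1 * exp (1 / 128 * k)) * exp (- c1 * exp (1 / 128 * k)) \<le> C * exp (- c1 * exp (1 / 128 * k))"
        by (intro mult_right_mono) auto
      then show ?thesis using f(2)[of k] by (simp add: exp_add[symmetric] del: exp_le_cancel_iff)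
    qed
  qed
  show ?thesis
  proof (rule exI[of _ C], rule exI[of _ c1], rule exI[of _ "1 / 128"], intro conjI allI impI)
    fix n k and f :: "nat \<Rightarrow> real"
    assume "antimono f" "\<forall>k. f k \<le> 1" "\<forall>k. b n < int k \<longrightarrow> f k \<le> 0"
      "N \<le> n \<longrightarrow> (\<forall>k. 8 * real k \<le> ln (real n) \<longrightarrow> f k \<le> A * exp (- c * exp (k / 4)))"
    then show "f k \<le> C * exp (- c1 * exp (1 / 128 * k))"
      by (intro bound[where f = f and n = n and k = k]) blast+
  qed (use C(1) c1 in auto)
qed

text \<open>
  At the early time both expected numbers are at least \<open>c e\<^bsup>k/4\<^esup>\<close> for large \<open>n\<close> and \<open>k \<le> L/8\<close>; the
  remaining \<open>n\<close> and \<open>k\<close> are left to \<open>extend_double_exponential_bound\<close>.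
\<close>

lemma order_stat_tau_lower_tail:
  fixes m l i :: nat
  assumes i: "1 \<le> i"
  shows "\<exists>C c1 c2. 0 < C \<and> 0 < c1 \<and> 0 < c2 \<and> (\<forall>(M :: 'a measure) P n k.
    iid_unit_poisson_processes M P \<longrightarrow> i \<le> n \<longrightarrow>
      \<P>(\<omega> in M. int (order_stat P n i (tau P m l n \<omega>) \<omega>) - centering_b m n \<le> - int k)
        \<le> C * exp (- c1 * exp (c2 * real k)))"
proof -
  obtain N where N: "\<And>n. N \<le> n \<Longrightarrow> 1 \<le> ln (ln (real n)) \<and> (ln (ln (real n)))\<^sup>2 \<le> ln (real n)
     \<and> 1 \<le> ln (real n) \<and> 3 / 2 * ln (real n) \<le> centering_a m n \<and> centering_a m n \<le> 4 * ln (real n) - 1"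
    using eventually_centering_a_bounds[of m] unfolding eventually_sequentially by blast
  define D where "D = m + 2 + \<bar>centering_offset m\<bar>"
  define c where "c = min (1 / (2 ^ m * fact m)) (exp (centering_offset m - 2 - 2 * D\<^sup>2 - ln 4 / 2))"
  have half_pos: "0 < c / 2" by (simp add: c_def)
  define A :: real where "A = 2 ^ l + 2 ^ i"
  have A: "0 < A" by (simp add: A_def add_pos_pos)
  have "centering_b m n \<le> 4 * ln (real n)" "0 \<le> ln (real n)" if "N \<le> n" for n
    using N[OF that] unfolding centering_b_def by linarith+
  then have b: "\<forall>n\<ge>N. centering_b m n \<le> 4 * ln (real n)" and L: "\<forall>n\<ge>N. 0 \<le> ln (real n)" by blast+
  obtain C c1 c2 where C: "0 < C" "0 < c1" "0 < c2"
    and extend: "\<forall>n (f :: nat \<Rightarrow> real) k.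
      antimono f \<longrightarrow> (\<forall>k. f k \<le> 1) \<longrightarrow> (\<forall>k. centering_b m n < int k \<longrightarrow> f k \<le> 0) \<longrightarrow>
      (N \<le> n \<longrightarrow> (\<forall>k. 8 * real k \<le> ln (real n) \<longrightarrow> f k \<le> A * exp (- (c / 2) * exp (k / 4)))) \<longrightarrow>
      f k \<le> C * exp (- c1 * exp (c2 * k))"
    using extend_double_exponential_bound[OF half_pos A b L] by (elim exE conjE)
  show ?thesis
  proof (rule exI[of _ C], rule exI[of _ c1], rule exI[of _ c2], intro conjI C allI impI)
    fix M :: "'a measure" and P and n k :: nat
    assume "iid_unit_poisson_processes M P" and n: "i \<le> n"
    then interpret iid_unit_poisson_processes M P by simp
    let ?M = "\<lambda>\<omega>. order_stat P n i (tau P m l n \<omega>) \<omega>"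
    let ?E = "\<lambda>k. {\<omega> \<in> space M. int (?M \<omega>) - centering_b m n \<le> - int k}"
    have ev: "?E k \<in> events" for k
    proof -
      have "?M -` {x. int x - centering_b m n \<le> - int k} \<inter> space M \<in> events"
        by (rule measurable_sets[OF measurable_order_stat_tau[OF i n]]) simp
      also have "?M -` {x. int x - centering_b m n \<le> - int k} \<inter> space M = ?E k" by auto
      finally show ?thesis .
    qed
    show "prob (?E k) \<le> C * exp (- c1 * exp (c2 * k))"
    proof (rule extend[rule_format])
      show "antimono (\<lambda>k. prob (?E k))"
        using ev by (intro antimonoI finite_measure_mono) auto
      show "prob (?E k) \<le> 1" for k by (rule prob_le_1)
      show "prob (?E k) \<le> 0" if "centering_b m n < int k" for k
      proof -
        have "?E k = {}" using that by auto
        then show ?thesis by (simp only: measure_empty order.refl)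
      qed
      show "prob (?E k) \<le> A * exp (- (c / 2) * exp (k / 4))"
        if "N \<le> n" and k: "8 * real k \<le> ln (real n)" for k
      proof -
        note N = N[OF \<open>N \<le> n\<close>]
        have n0: "0 < n" using i n by simp
        let ?t = "early_time m n k"
        let ?q = "c * exp (k / 4)"
        have "0 \<le> m * ln (ln (real n))" using N by simp
        then have t: "0 < ?t" using N k unfolding early_time_def by linarith
        have "?q \<le> 1 / (2 ^ m * fact m) * exp (k / 4)"
          unfolding c_def by (intro mult_right_mono) auto
        also have "\<dots> \<le> n * measure_pmf.prob (poisson_pmf ?t) {..m}"
          using N k n0 by (intro early_time_straggler_bound) auto
        finally have p: "?q \<le> n * measure_pmf.prob (poisson_pmf ?t) {..m}" .
        have "?q \<le> exp (centering_offset m - 2 - 2 * D\<^sup>2 - ln 4 / 2) * exp (k / 4)"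
          unfolding c_def by (intro mult_right_mono) auto
        also have "\<dots> \<le> n * measure_pmf.prob (poisson_pmf ?t) {j. centering_b m n - real k < real j}"
          using N k n0 unfolding D_def by (intro early_time_leader_bound) auto
        finally have q: "?q \<le> n * measure_pmf.prob (poisson_pmf ?t) {j. centering_b m n - real k < real j}" .
        have "int (?M \<omega>) - centering_b m n \<le> - int k \<longleftrightarrow> real (?M \<omega>) \<le> centering_b m n - real k" for \<omega>
          by linarith
        then have "prob (?E k) = prob {\<omega> \<in> space M. real (?M \<omega>) \<le> centering_b m n - real k}"
          by simp
        also have "\<dots> \<le> 2 ^ l * exp (- ?q / 2) + 2 ^ i * exp (- ?q / 2)"
          by (rule prob_order_stat_tau_le_bound[OF t i n p q])
        also have "\<dots> = A * exp (- (c / 2) * exp (k / 4))"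
          by (simp add: A_def distrib_right)
        finally show ?thesis .
      qed
    qed
  qed
qed

section \<open>Both tails together\<close>

text \<open>
  With \<open>e\<^sup>y \<ge> y\<^sup>2/2\<close> it suffices that the quadratic \<open>c1 c2\<^sup>2 x\<^sup>2/2 - x\<close> is bounded below; completing
  the square gives the constant.
\<close>

lemma double_exponential_le_exp:
  fixes c1 c2 x :: real
  assumes c: "0 < c1" "0 < c2" and x: "0 \<le> x"
  shows "exp (- c1 * exp (c2 * x)) \<le> exp (1 / (2 * c1 * c2\<^sup>2)) * exp (- x)"
proof -
  have "(c2 * x)\<^sup>2 / 2 \<le> exp (c2 * x)"
    using exp_lower_Taylor_quadratic[of "c2 * x"] c x mult_nonneg_nonneg[of c2 x] by linarith
  then have "c1 * ((c2 * x)\<^sup>2 / 2) \<le> c1 * exp (c2 * x)"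
    using c by (intro mult_left_mono) auto
  moreover have "0 \<le> (c1 * c2\<^sup>2 * x - 1)\<^sup>2 / (2 * c1 * c2\<^sup>2)"
    using c by simp
  moreover have "(c1 * c2\<^sup>2 * x - 1)\<^sup>2 / (2 * c1 * c2\<^sup>2) = c1 * ((c2 * x)\<^sup>2 / 2) - x + 1 / (2 * c1 * c2\<^sup>2)"
    using c by (simp add: field_simps power2_eq_square)
  ultimately have "- c1 * exp (c2 * x) \<le> 1 / (2 * c1 * c2\<^sup>2) - x" by linarith
  then show ?thesis unfolding exp_add[symmetric] by simp
qed

theorem lemma9p2:
  fixes m l i :: nat and \<epsilon> :: real
  assumes "1 \<le> i" and "0 < \<epsilon>"
  shows "\<exists>C1 C2 C3 c1 c2 :: real. 0 < C1 \<and> 0 < C2 \<and> 0 < C3 \<and> 0 < c1 \<and> 0 < c2 \<and>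
    (\<forall>(M :: 'a measure) P. iid_unit_poisson_processes M P \<longrightarrow>
      (\<forall>n k :: nat. i \<le> n \<longrightarrow> l < n \<longrightarrow> 2 \<le> n \<longrightarrow>
        \<P>(\<omega> in M. int (order_stat P n i (tau P m l n \<omega>) \<omega>) - centering_b m n > int k)
            \<le> C1 * exp (- (1 - \<epsilon>) * real k / exp 1) \<and>
        \<P>(\<omega> in M. int (order_stat P n i (tau P m l n \<omega>) \<omega>) - centering_b m n \<le> - int k)
            \<le> C2 * exp (- c1 * exp (c2 * real k)) \<and>
        C2 * exp (- c1 * exp (c2 * real k)) \<le> C3 * exp (- real k)))"
proof -
  obtain C1 where C1: "0 < C1"
    and upper: "\<forall>(M :: 'a measure) P n k. iid_unit_poisson_processes M P \<longrightarrow> i \<le> n \<longrightarrow> 2 \<le> n \<longrightarrow>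
      \<P>(\<omega> in M. int (order_stat P n i (tau P m l n \<omega>) \<omega>) - centering_b m n > int k)
        \<le> C1 * exp (- (1 - \<epsilon>) * real k / exp 1)"
    using order_stat_tau_upper_tail[OF assms, of m l] by (elim exE conjE)
  obtain C2 c1 c2 where C2: "0 < C2" "0 < c1" "0 < c2"
    and lower: "\<forall>(M :: 'a measure) P n k. iid_unit_poisson_processes M P \<longrightarrow> i \<le> n \<longrightarrow>
      \<P>(\<omega> in M. int (order_stat P n i (tau P m l n \<omega>) \<omega>) - centering_b m n \<le> - int k)
        \<le> C2 * exp (- c1 * exp (c2 * real k))"
    using order_stat_tau_lower_tail[OF assms(1), of m l] by (elim exE conjE)
  have "C2 * exp (- c1 * exp (c2 * real k))
      \<le> (C2 * exp (1 / (2 * c1 * c2\<^sup>2))) * exp (- real k)" for k :: nat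
    using mult_left_mono[OF double_exponential_le_exp[OF C2(2,3), of "real k"], of C2] C2(1)
    by (simp add: mult.assoc)
  then show ?thesis
    using C1 C2 upper lower
    by - (rule exI[of _ C1], rule exI[of _ C2], rule exI[of _ "C2 * exp (1 / (2 * c1 * c2\<^sup>2))"],
        rule exI[of _ c1], rule exI[of _ c2], simp)
qed

end
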